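(* Let $\alpha\in\mathbb{R}$ and let $(v,f,p)$, with $v,f,p\in C^1(\mathbb{S}^2)$, be a (nontrivial) solution with parameter $\alpha$ whose vorticity $\Omega=\nabla\times V$ vanishes in $\mathbb{R}^3\setminus\{0\}$. Then $\alpha\in\mathbb{Z}\setminus\{1\}$ and the solution is given by $$(1-\alpha)v=\nabla f,\qquad p=-\tfrac12 f^2-\tfrac{1}{2(1-\alpha)^2}|\nabla f|^2,$$ where $f$ is a constant multiple of one of the spherical harmonics $Y_l^m$, $1-\alpha=l$, $-l\le m\le l$. Moreover, in this case $H=0$.
   Context: $\mathbb{S}^2$ is the unit sphere in $\mathbb{R}^3$ with outward unit normal $\vec n$. A $C^k$-solution with parameter $\alpha$ is a triple $(v,f,p)$, where $v$ is a tangent vector field and $f,p$ are functions on $\mathbb{S}^2$, all of class $C^k$ ($k\ge1$), such that $$V(x)=\frac{v+f\vec n}{|x|^{\alpha}},\qquad P(x)=\frac{p}{|x|^{2\alpha}}$$ ($v,f,p,\vec n$ evaluated at $x/|x|$) solve the stationary Euler system $V\cdot\nabla V+\nabla P=0$, $\operatorname{div}V=0$ in $\mathbb{R}^3\setminus\{0\}$. Equivalently, on $\mathbb{S}^2$, $$(2-\alpha)f+\operatorname{div}v=0,\quad v\nabla f=|v|^2+\alpha f^2+2\alpha p,\quad (1-\alpha)fv+v\nabla v=-\nabla p,$$ where $v\nabla f=\langle v,\nabla f\rangle$ and $v\nabla v$ is the covariant derivative. In the statement $\nabla f$ is the gradient on $\mathbb{S}^2$, and $Y_l^m$ are the spherical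 harmonics on $\mathbb{S}^2$, eigenfunctions of the Laplace-Beltrami operator: $\Delta f=-(2-\alpha)(1-\alpha)f=-(l+1)l\,f$. The Bernoulli function is $H=|v|^2+f^2+2p:\mathbb{S}^2\to\mathbb{R}$.
   Formalization: Proved with f a linear combination of the Y_l^m, -l≤m≤l (a single Y_l^m fails for l=2); for l<0 degree -l-1 is used; for α=0 the formula for p holds up to an additive constant b and H=2b, since the pressure is then determined only up to a constant. *)

theory Defs
  imports "HOL-Analysis.Analysis" "HOL-Computational_Algebra.Polynomial"
begin

section \<open>Vector calculus in Euclidean 3-space\<close>

definition C1_on :: "(real^3) set \<Rightarrow> (real^3 \<Rightarrow> 'b::real_normed_vector) \<Rightarrow> bool" where
  "C1_on U g \<longleftrightarrow> (\<exists>g' :: real^3 \<Rightarrow> ((real^3) \<Rightarrow>\<^sub>L 'b).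
     (\<forall>x\<in>U. (g has_derivative blinfun_apply (g' x)) (at x)) \<and> continuous_on U g')"

text \<open>The operators below are built from \<open>frechet_derivative\<close>, so they are only meaningful
  at points of differentiability.\<close>

definition partial :: "3 \<Rightarrow> (real^3 \<Rightarrow> 'b::real_normed_vector) \<Rightarrow> real^3 \<Rightarrow> 'b" where
  "partial i g x = frechet_derivative g (at x) (axis i 1)"

definition grad :: "(real^3 \<Rightarrow> real) \<Rightarrow> real^3 \<Rightarrow> real^3" where
  "grad g x = (\<chi> i. partial i g x)"

definition divergence :: "(real^3 \<Rightarrow> real^3) \<Rightarrow> real^3 \<Rightarrow> real" where
  "divergence W x = (\<Sum>i\<in>UNIV. partial i W x $ i)"

definition curl :: "(real^3 \<Rightarrow> real^3) \<Rightarrow> real^3 \<Rightarrow> real^3" where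
  "curl W x = vector [partial 2 W x $ 3 - partial 3 W x $ 2,
                      partial 3 W x $ 1 - partial 1 W x $ 3,
                      partial 1 W x $ 2 - partial 2 W x $ 1]"

definition advection :: "(real^3 \<Rightarrow> real^3) \<Rightarrow> (real^3 \<Rightarrow> real^3) \<Rightarrow> real^3 \<Rightarrow> real^3" where
  "advection V W x = (\<Sum>i\<in>UNIV. V x $ i *\<^sub>R partial i W x)"


section \<open>The unit sphere\<close>

text \<open>Functions on the sphere are total functions on \<open>real^3\<close> of which only the values on
  the sphere are used. The outward unit normal at a point \<open>x\<close> of the sphere is \<open>x\<close> itself.\<close>

abbreviation S2 :: "(real^3) set" where
  "S2 \<equiv> sphere 0 1"

definition C1_on_S2 :: "(real^3 \<Rightarrow> 'b::real_normed_vector) \<Rightarrow> bool" where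
  "C1_on_S2 g \<longleftrightarrow> (\<exists>U h. open U \<and> S2 \<subseteq> U \<and> C1_on U h \<and> (\<forall>x\<in>S2. h x = g x))"

definition tangent_field :: "(real^3 \<Rightarrow> real^3) \<Rightarrow> bool" where
  "tangent_field v \<longleftrightarrow> (\<forall>x\<in>S2. v x \<bullet> x = 0)"

text \<open>The extension of \<open>f\<close> constant along rays has no radial derivative, so at a point of the
  sphere its Euclidean gradient is the Riemannian gradient of \<open>f\<close>.\<close>

definition surface_grad :: "(real^3 \<Rightarrow> real) \<Rightarrow> real^3 \<Rightarrow> real^3" where
  "surface_grad f x = grad (\<lambda>y. f (y /\<^sub>R norm y)) x"


section \<open>Homogeneous stationary Euler flows\<close>

definition velocity ::
  "real \<Rightarrow> (real^3 \<Rightarrow> real^3) \<Rightarrow> (real^3 \<Rightarrow> real) \<Rightarrow> real^3 \<Rightarrow> real^3" where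
  "velocity \<alpha> v f x =
     (let n = x /\<^sub>R norm x in (v n + f n *\<^sub>R n) /\<^sub>R (norm x powr \<alpha>))"

definition pressure :: "real \<Rightarrow> (real^3 \<Rightarrow> real) \<Rightarrow> real^3 \<Rightarrow> real" where
  "pressure \<alpha> p x = p (x /\<^sub>R norm x) / norm x powr (2 * \<alpha>)"

definition vorticity ::
  "real \<Rightarrow> (real^3 \<Rightarrow> real^3) \<Rightarrow> (real^3 \<Rightarrow> real) \<Rightarrow> real^3 \<Rightarrow> real^3" where
  "vorticity \<alpha> v f = curl (velocity \<alpha> v f)"

definition C1_solution ::
  "real \<Rightarrow> (real^3 \<Rightarrow> real^3) \<Rightarrow> (real^3 \<Rightarrow> real) \<Rightarrow> (real^3 \<Rightarrow> real) \<Rightarrow> bool" where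
  "C1_solution \<alpha> v f p \<longleftrightarrow>
     C1_on_S2 v \<and> C1_on_S2 f \<and> C1_on_S2 p \<and> tangent_field v \<and>
     (\<forall>x. x \<noteq> 0 \<longrightarrow>
        advection (velocity \<alpha> v f) (velocity \<alpha> v f) x + grad (pressure \<alpha> p) x = 0 \<and>
        divergence (velocity \<alpha> v f) x = 0)"

definition trivial_solution ::
  "(real^3 \<Rightarrow> real^3) \<Rightarrow> (real^3 \<Rightarrow> real) \<Rightarrow> (real^3 \<Rightarrow> real) \<Rightarrow> bool" where
  "trivial_solution v f p \<longleftrightarrow> (\<forall>x\<in>S2. v x = 0 \<and> f x = 0 \<and> p x = 0)"

definition bernoulli ::
  "(real^3 \<Rightarrow> real^3) \<Rightarrow> (real^3 \<Rightarrow> real) \<Rightarrow> (real^3 \<Rightarrow> real) \<Rightarrow> real^3 \<Rightarrow> real" where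
  "bernoulli v f p x = (norm (v x))\<^sup>2 + (f x)\<^sup>2 + 2 * p x"


section \<open>Spherical harmonics\<close>

text \<open>Rodrigues' formula.\<close>

definition legendre :: "nat \<Rightarrow> real poly" where
  "legendre L = smult (1 / (2 ^ L * fact L)) ((pderiv ^^ L) ([:-1, 0, 1:] ^ L))"

text \<open>The real orthonormal spherical harmonics. In spherical coordinates they are
  \<open>N P_L^m(cos \<theta>) cos (m \<phi>)\<close> for \<open>m \<ge> 0\<close> and \<open>N P_L^k(cos \<theta>) sin (k \<phi>)\<close> for \<open>k = -m > 0\<close>,
  where \<open>P_L^k(t) = (1 - t^2)^(k/2) (d/dt)^k P_L(t)\<close> (no Condon-Shortley sign). On the sphere
  \<open>cos \<theta> = x $ 3\<close> and \<open>(sin \<theta>)^k exp (i k \<phi>) = (x $ 1 + i x $ 2)^k\<close>; the latter form needs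
  no angle at the poles.\<close>

definition sph_harm :: "nat \<Rightarrow> int \<Rightarrow> real^3 \<Rightarrow> real" where
  "sph_harm L m x =
     (let k = nat \<bar>m\<bar>; w = Complex (x $ 1) (x $ 2) ^ k in
      sqrt ((if m = 0 then 1 else 2) * (2 * real L + 1) / (4 * pi) * (fact (L - k) / fact (L + k)))
      * poly ((pderiv ^^ k) (legendre L)) (x $ 3)
      * (if m \<ge> 0 then Re w else Im w))"

text \<open>The eigenvalue \<open>(l + 1) l\<close> is invariant under \<open>l \<mapsto> -l - 1\<close>. For a negative integer \<open>l\<close>,
  \<open>Y_l^m\<close> stands for \<open>Y_(-l-1)^m\<close>.\<close>

definition harm_degree :: "int \<Rightarrow> nat" where
  "harm_degree l = nat (if l \<ge> 0 then l else - l - 1)"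

end

theory Submission
  imports Defs "HOL-Complex_Analysis.Complex_Analysis"
begin

text \<open>An irrotational \<open>V\<close> has a symmetric derivative, so by homogeneity
  \<open>\<nabla>(V \<bullet> x) = (1 - \<alpha>) V\<close>. Together with \<open>div V = 0\<close> this makes \<open>f\<close> an eigenfunction of the spherical
  Laplacian with eigenvalue \<open>(1 - \<alpha>) (2 - \<alpha>)\<close>. Eigenfunctions with different eigenvalues are
  orthogonal by Green's identity, and the spherical harmonics span all polynomials on the sphere,
  so by Stone-Weierstrass a nonzero \<open>f\<close> forces an eigenvalue \<open>L (L + 1)\<close>, and then \<open>f\<close>
  equals its projection onto the harmonics of degree \<open>L\<close>.
  For \<open>\<alpha> = 1\<close> the function \<open>f\<close> is constant, hence \<open>0\<close> by the divergence theorem, and \<open>v\<close> is a harmonic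
  one-form on the sphere; in the stereographic coordinate it is an entire function that vanishes at
  infinity, hence \<open>0\<close> by Liouville's theorem.
  Finally, \<open>V \<cdot> \<nabla>V = \<nabla>|V|\<^sup>2 / 2\<close> shows that \<open>|V|\<^sup>2 / 2 + P\<close> is constant, and homogeneity makes
  the constant vanish when \<open>\<alpha> \<noteq> 0\<close>.\<close>


section \<open>Divergence theorem with a radial cutoff\<close>

text \<open>The hypotheses give \<open>f\<close> only one derivative, while a Laplacian needs two.
  The gradient identity repairs this: it expresses the gradient of \<open>f\<close> through
  \<open>V\<close> and \<open>f\<close> themselves, so this gradient is again C^1 and its divergence
  makes sense. Surface measure is avoided: functions on the sphere are extended constantly along
  rays, the Laplacian is the Euclidean one of the extension, and surface integrals become integrals
  over a shell with a radial cutoff. The value \<open>\<alpha> = 1\<close> needs a separate argument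
  because the identity then says only that the gradient vanishes and gives no information on
  \<open>v\<close>; that \<open>v\<close> vanishes reflects that the sphere carries no nonzero
  harmonic one-form. The value \<open>\<alpha> = 0\<close> is exceptional in another way: the
  pressure is then homogeneous of degree 0 and may be shifted by a constant. The contradiction for a
  vanishing \<open>f\<close> still works because (1 - 0)(2 - 0) = 1(1 + 1) is an admissible
  eigenvalue, so this case never reaches it.\<close>

text \<open>The integrals of the difference quotients vanish by translation invariance.\<close>

lemma integral_directional_derivative_eq_0:
  fixes g :: "'a::euclidean_space \<Rightarrow> real"
  assumes deriv: "\<And>x. (g has_derivative g' x) (at x)"
    and supp: "\<And>x. norm x > R \<Longrightarrow> g x = 0"
    and bound: "\<And>x. \<bar>g' x e\<bar> \<le> M"
  shows "integrable lborel (\<lambda>x. g' x e)" and "(\<integral>x. g' x e \<partial>lborel) = 0"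
proof -
  have cont: "continuous_on UNIV g"
    by (rule continuous_at_imp_continuous_on) (auto intro: has_derivative_continuous[OF deriv])
  define s where "s n x = (g (x + e /\<^sub>R real (Suc n)) - g x) * real (Suc n)" for n x
  \<comment> \<open>Dominating function: the shift in \<open>s n\<close> has length at most
    \<open>norm e\<close>, so every quotient vanishes outside the ball enlarged by
    \<open>norm e\<close>; inside, the mean value theorem bounds it by \<open>M\<close>.\<close>
  define w where "w x = indicator (cball 0 (R + norm e)) x *\<^sub>R M" for x :: 'a
  have gint: "integrable lborel g"
  proof -
    have "integrable lborel (\<lambda>x. indicator (cball 0 R) x *\<^sub>R g x)"
      by (rule borel_integrable_compact) (use cont continuous_on_subset in auto)
    moreover have "(\<lambda>x. indicator (cball 0 R) x *\<^sub>R g x) = g"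
      using supp by (auto simp: indicator_def fun_eq_iff not_le[symmetric])
    ultimately show ?thesis by simp
  qed
  have [measurable]: "g \<in> borel_measurable borel"
    using cont by (rule borel_measurable_continuous_onI)
  have gtrans: "integrable lborel (\<lambda>x. g (x + c)) \<and> (\<integral>x. g (x + c) \<partial>lborel) = (\<integral>x. g x \<partial>lborel)" for c
  proof -
    have "integrable (distr lborel borel ((+) c)) g"
      using gint lborel_distr_plus[of c] by simp
    then have 1: "integrable lborel (\<lambda>x. g (c + x))"
      by (subst (asm) integrable_distr_eq) auto
    have "(\<integral>x. g x \<partial>lborel) = (\<integral>x. g x \<partial>distr lborel borel ((+) c))"
      using lborel_distr_plus[of c] by simp
    also have "\<dots> = (\<integral>x. g (c + x) \<partial>lborel)"
      by (subst integral_distr) auto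
    finally show ?thesis using 1 by (simp add: add.commute)
  qed
  have sint: "(\<integral>x. s n x \<partial>lborel) = 0" for n
    unfolding s_def using gtrans[of "e /\<^sub>R real (Suc n)"] gint by simp
  have lin: "linear (g' x)" for x
    using deriv has_derivative_linear by blast
  have mvt: "\<bar>g (x + h *\<^sub>R e) - g x\<bar> \<le> h * M" if "h > 0" for x h
  proof -
    have "((\<lambda>t. g (x + t *\<^sub>R e)) has_real_derivative g' (x + t *\<^sub>R e) e) (at t)" for t
    proof -
      have "((\<lambda>t. g (x + t *\<^sub>R e)) has_derivative (\<lambda>d. g' (x + t *\<^sub>R e) (d *\<^sub>R e))) (at t)"
        by (rule has_derivative_compose[OF _ deriv, of "\<lambda>t. x + t *\<^sub>R e" "\<lambda>d. d *\<^sub>R e", simplified])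
           (auto intro!: derivative_eq_intros)
      then show ?thesis
        by (simp add: has_field_derivative_def linear_scale[OF lin] mult.commute[of _ "g' _ e"])
    qed
    then obtain z where "g (x + h *\<^sub>R e) - g (x + 0 *\<^sub>R e) = (h - 0) * g' (x + z *\<^sub>R e) e"
      using MVT2[of 0 h "\<lambda>t. g (x + t *\<^sub>R e)" "\<lambda>t. g' (x + t *\<^sub>R e) e"] \<open>h > 0\<close> by blast
    then show ?thesis
      using bound[of "x + z *\<^sub>R e"] that by (simp add: abs_mult)
  qed
  have slim: "(\<lambda>n. s n x) \<longlonglongrightarrow> g' x e" for x
  proof -
    have "((\<lambda>t. g (x + t *\<^sub>R e)) has_derivative (\<lambda>d. g' (x + 0 *\<^sub>R e) (d *\<^sub>R e))) (at 0)"
      by (rule has_derivative_compose[OF _ deriv, of "\<lambda>t. x + t *\<^sub>R e" "\<lambda>d. d *\<^sub>R e", simplified])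
           (auto intro!: derivative_eq_intros)
    then have "((\<lambda>t. g (x + t *\<^sub>R e)) has_real_derivative g' x e) (at 0)"
      by (simp add: has_field_derivative_def linear_scale[OF lin] mult.commute[of _ "g' _ e"])
    then have "((\<lambda>h. (g (x + h *\<^sub>R e) - g x) / h) \<longlongrightarrow> g' x e) (at 0)"
      by (simp add: DERIV_def)
    moreover have "filterlim (\<lambda>n. inverse (real (Suc n))) (at 0) sequentially"
      unfolding filterlim_at using LIMSEQ_inverse_real_of_nat by auto
    ultimately have "(\<lambda>n. (g (x + inverse (real (Suc n)) *\<^sub>R e) - g x) / inverse (real (Suc n))) \<longlonglongrightarrow> g' x e"
      by (rule filterlim_compose)
    then show ?thesis by (simp add: s_def divide_simps)
  qed
  have sbd: "norm (s n x) \<le> w x" for n x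
  proof (cases "norm x \<le> R + norm e")
    case True
    have "\<bar>g (x + inverse (real (Suc n)) *\<^sub>R e) - g x\<bar> * real (Suc n)
        \<le> inverse (real (Suc n)) * M * real (Suc n)"
      by (rule mult_right_mono[OF mvt]) auto
    also have "\<dots> = M" by simp
    finally show ?thesis using True by (simp add: s_def w_def abs_mult del: of_nat_Suc)
  next
    case False
    have "norm (e /\<^sub>R real (Suc n)) \<le> norm e"
      using mult_right_mono[of "inverse (real (Suc n))" 1 "norm e"] by (simp add: inverse_eq_divide)
    then have "norm (x + e /\<^sub>R real (Suc n)) > R"
      using False norm_triangle_ineq4[of "x + e /\<^sub>R real (Suc n)" "e /\<^sub>R real (Suc n)"] by simp
    moreover have "norm x > R" using False norm_ge_zero[of e] by linarith
    ultimately show ?thesis using supp False by (simp add: s_def w_def)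
  qed
  have wint: "integrable lborel w"
    unfolding w_def by (rule borel_integrable_compact) auto
  have [measurable]: "s n \<in> borel_measurable borel" for n
    unfolding s_def[abs_def] by measurable
  \<comment> \<open>The derivative is not assumed continuous; it is measurable as the pointwise
    limit of the continuous quotients.\<close>
  have meas: "(\<lambda>x. g' x e) \<in> borel_measurable lborel"
    by (rule borel_measurable_LIMSEQ_metric[of s]) (auto intro: slim)
  show "integrable lborel (\<lambda>x. g' x e)"
    by (rule integrable_dominated_convergence[OF meas _ wint, of s]) (use slim sbd in \<open>auto simp del: real_norm_def\<close>)
  have "(\<lambda>n. \<integral>x. s n x \<partial>lborel) \<longlonglongrightarrow> (\<integral>x. g' x e \<partial>lborel)"
    by (rule integral_dominated_convergence[OF meas _ wint, of s]) (use slim sbd in \<open>auto simp del: real_norm_def\<close>)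
  then show "(\<integral>x. g' x e \<partial>lborel) = 0"
    by (simp add: sint LIMSEQ_const_iff)
qed


text \<open>To be evaluated at t = |x|^2, so that 1 and 4 bound the shell of radii 1 and 2. Squaring
  the positive part makes the cutoff C^1, which is all the divergence theorem uses.\<close>

definition bump :: "real \<Rightarrow> real" where
  "bump t = (max 0 ((t - 1) * (4 - t)))\<^sup>2"

lemma max_0_shell_eq_0: "t \<le> 1 \<or> t \<ge> 4 \<Longrightarrow> max 0 ((t - 1) * (4 - t)) = (0::real)"
  using mult_nonpos_nonneg[of "t - 1" "4 - t"] mult_nonneg_nonpos[of "t - 1" "4 - t"]
  by (intro max_absorb1) auto

lemma bump_eq_0: "t \<le> 1 \<or> t \<ge> 4 \<Longrightarrow> bump t = 0"
  by (simp only: bump_def max_0_shell_eq_0) simp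

lemma bump_pos: "1 < t \<Longrightarrow> t < 4 \<Longrightarrow> bump t > 0"
  using mult_pos_pos[of "t - 1" "4 - t"] by (simp add: bump_def)

lemma bump_nonneg: "bump t \<ge> 0"
  by (simp add: bump_def)

lemma continuous_on_bump [continuous_intros]:
  "continuous_on S h \<Longrightarrow> continuous_on S (\<lambda>x. bump (h x))"
  unfolding bump_def by (intro continuous_intros)

text \<open>The square removes the kink at 0: the difference quotient there is at most |h| in
  absolute value.\<close>

lemma DERIV_max_0_square: "((\<lambda>y::real. (max 0 y)\<^sup>2) has_real_derivative 2 * max 0 y) (at y)"
proof (cases y "0::real" rule: linorder_cases)
  case less
  have "((\<lambda>y::real. 0) has_real_derivative 2 * max 0 y) (at y)" using less by simp
  then show ?thesis
    by (rule has_field_derivative_transform_within_open[where S = "{..<0}"]) (use less in auto)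
next
  case greater
  have "((\<lambda>y::real. y\<^sup>2) has_real_derivative 2 * max 0 y) (at y)"
    using greater by (auto intro!: derivative_eq_intros)
  then show ?thesis
    by (rule has_field_derivative_transform_within_open[where S = "{0<..}"]) (use greater in auto)
next
  case equal
  have "((\<lambda>h. (max 0 h)\<^sup>2 / h) \<longlongrightarrow> 0) (at (0::real))"
  proof (rule Lim_null_comparison[where g = "\<lambda>h. \<bar>h\<bar>"])
    show "\<forall>\<^sub>F h in at (0::real). norm ((max 0 h)\<^sup>2 / h) \<le> \<bar>h\<bar>"
      by (rule always_eventually) (auto simp: max_def power2_eq_square)
  qed (auto intro!: tendsto_eq_intros)
  then show ?thesis using equal by (simp add: DERIV_def)
qed

definition bump' :: "real \<Rightarrow> real" where
  "bump' t = 2 * max 0 ((t - 1) * (4 - t)) * (5 - 2 * t)"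

lemma DERIV_bump: "(bump has_real_derivative bump' t) (at t)"
proof -
  have "((\<lambda>t. (t - 1) * (4 - t)) has_real_derivative (5 - 2 * t)) (at t)"
    by (auto intro!: derivative_eq_intros simp: algebra_simps)
  from DERIV_chain2[OF DERIV_max_0_square this] show ?thesis
    by (simp add: bump_def[abs_def] bump'_def)
qed

lemma bump'_eq_0: "t \<le> 1 \<or> t \<ge> 4 \<Longrightarrow> bump' t = 0"
  by (simp only: bump'_def max_0_shell_eq_0 mult_zero_left mult_zero_right)

lemma continuous_on_bump' [continuous_intros]:
  "continuous_on S h \<Longrightarrow> continuous_on S (\<lambda>x. bump' (h x))"
  unfolding bump'_def by (intro continuous_intros)


lemma bump_shell:
  fixes x :: "'a::euclidean_space"
  assumes "x \<notin> cball 0 2 - ball 0 1"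
  shows "bump (x \<bullet> x) = 0" and "bump' (x \<bullet> x) = 0"
proof -
  from assms consider "norm x < 1" | "norm x > 2" by fastforce
  then have "x \<bullet> x \<le> 1 \<or> x \<bullet> x \<ge> 4"
  proof cases
    case 1
    then show ?thesis by (simp add: dot_square_norm power_le_one)
  next
    case 2
    then have "2\<^sup>2 \<le> (norm x)\<^sup>2" by (intro power_mono) auto
    then show ?thesis by (simp add: dot_square_norm)
  qed
  then show "bump (x \<bullet> x) = 0" and "bump' (x \<bullet> x) = 0" using bump_eq_0 bump'_eq_0 by blast+
qed

text \<open>As \<open>A\<close> is tangential, the gradient of the radial cutoff does not contribute.\<close>

lemma bump_divergence_integral:
  fixes A :: "'a::euclidean_space \<Rightarrow> 'a" and G :: "'a \<Rightarrow> real"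
  assumes A: "\<And>x. x \<noteq> 0 \<Longrightarrow> (A has_derivative A' x) (at x)"
    and A'_cont: "\<And>e. continuous_on (- {0}) (\<lambda>x. A' x e)"
    and A_tangent: "\<And>x. x \<noteq> 0 \<Longrightarrow> A x \<bullet> x = 0"
    and G: "\<And>x. x \<noteq> 0 \<Longrightarrow> (G has_derivative (\<lambda>h. B x \<bullet> h)) (at x)"
    and B_cont: "continuous_on (- {0}) B"
  shows "integrable lborel (\<lambda>x. bump (x \<bullet> x) * (G x * (\<Sum>i\<in>Basis. A' x i \<bullet> i) + A x \<bullet> B x))" (is ?int)
    and "(\<integral>x. bump (x \<bullet> x) * (G x * (\<Sum>i\<in>Basis. A' x i \<bullet> i) + A x \<bullet> B x) \<partial>lborel) = 0" (is ?eq)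
proof -
  \<comment> \<open>The components of the field \<open>bump\<close> times \<open>G\<close> times
    \<open>A\<close>; summing their derivatives along the basis gives its divergence.\<close>
  define g where "g i x = bump (x \<bullet> x) * (G x * (A x \<bullet> i))" for i x
  define g' where "g' i x h = bump' (x \<bullet> x) * (2 * (x \<bullet> h)) * (G x * (A x \<bullet> i))
      + bump (x \<bullet> x) * ((B x \<bullet> h) * (A x \<bullet> i) + G x * (A' x h \<bullet> i))" for i x h
  note shell = bump_shell
  have deriv: "(g i has_derivative g' i x) (at x)" for i x
  proof (cases "x = 0")
    case False
    have 1: "((\<lambda>x. x \<bullet> x) has_derivative (\<lambda>h. 2 * (x \<bullet> h))) (at x)"
      by (auto intro!: derivative_eq_intros simp: inner_commute)
    have 2: "((\<lambda>x. bump (x \<bullet> x)) has_derivative (\<lambda>h. bump' (x \<bullet> x) * (2 * (x \<bullet> h)))) (at x)"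
      using has_derivative_compose[OF 1 DERIV_bump[unfolded has_field_derivative_def]] by simp
    have 3: "((\<lambda>x. A x \<bullet> i) has_derivative (\<lambda>h. A' x h \<bullet> i)) (at x)"
      using has_derivative_inner_left[OF A[OF False]] .
    show ?thesis
      unfolding g_def[abs_def] g'_def[abs_def]
      by (rule has_derivative_eq_rhs[OF has_derivative_mult[OF 2 has_derivative_mult[OF G[OF False] 3]]])
         (simp add: algebra_simps)
  next
    case True
    \<comment> \<open>Nothing is known about \<open>A\<close> and \<open>G\<close> at the origin,
      but the cutoff vanishes on the unit ball, so \<open>g i\<close> is locally zero there.\<close>
    have "((\<lambda>x::'a. 0::real) has_derivative g' i 0) (at 0)"
      by (auto simp: g'_def[abs_def] bump_eq_0 bump'_eq_0)
    then have "(g i has_derivative g' i 0) (at 0)"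
      by (rule has_derivative_transform_within_open[where s = "ball 0 1"])
         (use shell in \<open>auto simp: g_def\<close>)
    then show ?thesis using True by simp
  qed
  have compact: "compact (cball 0 2 - ball (0::'a) 1)"
    by (simp add: compact_diff)
  have G_cont: "continuous_on (- {0}) G"
    by (rule continuous_at_imp_continuous_on) (auto intro: has_derivative_continuous[OF G])
  have A_cont: "continuous_on (- {0}) A"
    by (rule continuous_at_imp_continuous_on) (auto intro: has_derivative_continuous[OF A])
  have "\<exists>M. \<forall>x. \<bar>g' i x i\<bar> \<le> M" for i
  proof -
    have sub: "cball 0 2 - ball (0::'a) 1 \<subseteq> - {0}" by auto
    have "continuous_on (cball 0 2 - ball 0 1) (\<lambda>x. g' i x i)"
      unfolding g'_def
      by (intro continuous_intros continuous_on_subset[OF G_cont sub] continuous_on_subset[OF A_cont sub]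
          continuous_on_subset[OF B_cont sub] continuous_on_subset[OF A'_cont sub])
    then have "bounded ((\<lambda>x. g' i x i) ` (cball 0 2 - ball 0 1))"
      using compact compact_continuous_image compact_imp_bounded by blast
    then obtain M where M: "\<And>x. x \<in> cball 0 2 - ball 0 1 \<Longrightarrow> \<bar>g' i x i\<bar> \<le> M"
      unfolding bounded_iff real_norm_def by blast
    have "\<bar>g' i x i\<bar> \<le> max M 0" for x
    proof (cases "x \<in> cball 0 2 - ball 0 1")
      case True
      then show ?thesis using M[of x] by simp
    next
      case False
      then show ?thesis using shell[of x] by (simp add: g'_def)
    qed
    then show ?thesis by blast
  qed
  then obtain M where M: "\<And>i x. \<bar>g' i x i\<bar> \<le> M i" by metis
  have supp: "g i x = 0" if "norm x > 2" for i x
    using shell[of x] that by (simp add: g_def)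
  have int: "integrable lborel (\<lambda>x. g' i x i)" "(\<integral>x. g' i x i \<partial>lborel) = 0" for i
    by (rule integral_directional_derivative_eq_0[of "g i" "g' i" 2 i "M i", OF deriv supp M]; assumption)+
  have "(\<Sum>i\<in>Basis. g' i x i) = bump (x \<bullet> x) * (G x * (\<Sum>i\<in>Basis. A' x i \<bullet> i) + A x \<bullet> B x)" for x
  proof (cases "x = 0")
    case True
    then show ?thesis by (simp add: g'_def bump_eq_0 bump'_eq_0)
  next
    case False
    have "(\<Sum>i\<in>Basis. g' i x i) = bump' (x \<bullet> x) * 2 * G x * (\<Sum>i\<in>Basis. (A x \<bullet> i) * (x \<bullet> i))
      + bump (x \<bullet> x) * (G x * (\<Sum>i\<in>Basis. A' x i \<bullet> i) + (\<Sum>i\<in>Basis. (A x \<bullet> i) * (B x \<bullet> i)))"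
      unfolding g'_def sum.distrib[symmetric] sum_distrib_left
      by (rule sum.cong) (simp_all add: algebra_simps)
    then show ?thesis
      using A_tangent[OF False] by (simp add: euclidean_inner[symmetric])
  qed
  then have eq: "(\<lambda>x. bump (x \<bullet> x) * (G x * (\<Sum>i\<in>Basis. A' x i \<bullet> i) + A x \<bullet> B x))
      = (\<lambda>x. \<Sum>i\<in>Basis. g' i x i)" by auto
  show ?int unfolding eq using int by auto
  show ?eq unfolding eq using int by simp
qed

section \<open>Eigenfunctions of the spherical Laplacian\<close>

text \<open>The Laplacian of a function constant along rays is homogeneous of degree -2. Dividing by
  \<open>x \<bullet> x\<close> absorbs this factor, so the divergence identity for an eigenfunction
  turns directly into a statement about \<open>sphere_int\<close>.\<close>

definition shell_weight :: "'a::euclidean_space \<Rightarrow> real" where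
  "shell_weight x = bump (x \<bullet> x) / (x \<bullet> x)"

lemma shell_weight_nonneg: "shell_weight x \<ge> 0"
  by (simp add: shell_weight_def bump_nonneg)

lemma shell_weight_0 [simp]: "shell_weight 0 = 0"
  by (simp add: shell_weight_def)

text \<open>A positive multiple of the surface integral of \<open>h\<close>: integrating over a shell avoids the
  surface measure.\<close>

definition sphere_int :: "('a::euclidean_space \<Rightarrow> real) \<Rightarrow> real" where
  "sphere_int h = (\<integral>x. shell_weight x * h (x /\<^sub>R norm x) \<partial>lborel)"

section \<open>Linearity, monotonicity and definiteness of the shell integral\<close>

lemma normalize_in_sphere: "x \<noteq> 0 \<Longrightarrow> x /\<^sub>R norm x \<in> sphere 0 1"
  for x :: "'a::real_normed_vector"
  by simp

lemma continuous_on_normalize: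
  fixes h :: "'a::real_normed_vector \<Rightarrow> 'b::topological_space"
  assumes "continuous_on (sphere 0 1) h" "0 \<notin> U"
  shows "continuous_on U (\<lambda>x. h (x /\<^sub>R norm x))"
proof (rule continuous_on_compose2[OF assms(1)])
  show "continuous_on U (\<lambda>x. x /\<^sub>R norm x)"
    using assms(2) by (intro continuous_intros) auto
  show "(\<lambda>x. x /\<^sub>R norm x) ` U \<subseteq> sphere 0 1"
  proof (rule image_subsetI)
    fix x assume "x \<in> U"
    then have "x \<noteq> 0" using assms(2) by auto
    then show "x /\<^sub>R norm x \<in> sphere 0 1" by (rule normalize_in_sphere)
  qed
qed

lemma integrable_sphere_int:
  fixes h :: "'a::euclidean_space \<Rightarrow> real"
  assumes "continuous_on (sphere 0 1) h"
  shows "integrable lborel (\<lambda>x. shell_weight x * h (x /\<^sub>R norm x))"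
proof -
  let ?K = "cball (0::'a) 2 - ball 0 1"
  have "integrable lborel (\<lambda>x. indicator ?K x *\<^sub>R (shell_weight x * h (x /\<^sub>R norm x)))"
    by (rule borel_integrable_compact)
       (auto simp: shell_weight_def intro!: continuous_intros continuous_on_normalize assms compact_diff)
  moreover have "(\<lambda>x. indicator ?K x *\<^sub>R (shell_weight x * h (x /\<^sub>R norm x)))
      = (\<lambda>x. shell_weight x * h (x /\<^sub>R norm x))"
    using bump_shell(1) by (auto simp: indicator_def fun_eq_iff shell_weight_def)
  ultimately show ?thesis by simp
qed

lemma sphere_int_cong:
  assumes "\<And>x. x \<in> sphere 0 1 \<Longrightarrow> g x = h x"
  shows "sphere_int g = sphere_int h"
  unfolding sphere_int_def
proof (rule Bochner_Integration.integral_cong)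
  fix x :: 'a
  show "shell_weight x * g (x /\<^sub>R norm x) = shell_weight x * h (x /\<^sub>R norm x)"
    using assms[OF normalize_in_sphere, of x] by (cases "x = 0") auto
qed simp

lemma sphere_int_add:
  assumes "continuous_on (sphere 0 1) g" "continuous_on (sphere 0 1) h"
  shows "sphere_int (\<lambda>x. g x + h x) = sphere_int g + sphere_int h"
  unfolding sphere_int_def distrib_left
  using assms by (simp add: integrable_sphere_int)

lemma sphere_int_cmult: "sphere_int (\<lambda>x. c * h x) = c * sphere_int h"
  unfolding sphere_int_def by (simp add: mult.left_commute)

lemma sphere_int_diff:
  assumes "continuous_on (sphere 0 1) g" "continuous_on (sphere 0 1) h"
  shows "sphere_int (\<lambda>x. g x - h x) = sphere_int g - sphere_int h"
  using sphere_int_add[of g "\<lambda>x. (-1) * h x"] sphere_int_cmult[of "-1" h] assms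
  by (simp add: continuous_on_minus)

lemma sphere_int_mono:
  assumes "continuous_on (sphere 0 1) g" "continuous_on (sphere 0 1) h"
    and "\<And>x. x \<in> sphere 0 1 \<Longrightarrow> g x \<le> h x"
  shows "sphere_int g \<le> sphere_int h"
  unfolding sphere_int_def
proof (rule integral_mono)
  fix x :: 'a
  show "shell_weight x * g (x /\<^sub>R norm x) \<le> shell_weight x * h (x /\<^sub>R norm x)"
    using assms(3)[OF normalize_in_sphere, of x] shell_weight_nonneg[of x]
    by (cases "x = 0") (auto intro!: mult_left_mono)
qed (use assms integrable_sphere_int in auto)

text \<open>By continuity, a positive value persists on a neighbourhood; the cone over it meets the
  open shell in a nonempty open set, which has positive measure, and the weight is positive
  there.\<close>

lemma sphere_int_eq_0_imp:
  assumes cont: "continuous_on (sphere 0 1) h"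
    and nonneg: "\<And>x. x \<in> sphere 0 1 \<Longrightarrow> h x \<ge> 0"
    and zero: "sphere_int h = 0" and y: "y \<in> sphere 0 1"
  shows "h y = 0"
proof (rule ccontr)
  assume "h y \<noteq> 0"
  then have hy: "h y > 0" using nonneg[OF y] by simp
  define U where "U = {x \<in> - {0}. 1 < norm x \<and> norm x < 2 \<and> 0 < h (x /\<^sub>R norm x)}"
  have "open U"
  proof -
    have "continuous_on (- {0}) (\<lambda>x. h (x /\<^sub>R norm x))"
      by (rule continuous_on_normalize[OF cont]) auto
    then have "open ({x. 1 < norm x} \<inter> {x. norm x < 2} \<inter> ((- {0}) \<inter> (\<lambda>x. h (x /\<^sub>R norm x)) -` {0<..}))"
      by (intro open_Int continuous_open_preimage open_Collect_less continuous_intros) auto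
    moreover have "{x. 1 < norm x} \<inter> {x. norm x < 2} \<inter> ((- {0}) \<inter> (\<lambda>x. h (x /\<^sub>R norm x)) -` {0<..}) = U"
      unfolding U_def by auto
    ultimately show ?thesis by simp
  qed
  \<comment> \<open>Any radius strictly between 1 and 2 would serve: \<open>y\<close> itself lies on
    the boundary of the shell, where the weight is 0.\<close>
  moreover have "(3/2) *\<^sub>R y \<in> U"
    using y hy by (auto simp: U_def)
  ultimately obtain r where r: "r > 0" "ball ((3/2) *\<^sub>R y) r \<subseteq> U"
    using open_contains_ball by blast
  have "AE x in lborel. shell_weight x * h (x /\<^sub>R norm x) = 0"
  proof -
    have "shell_weight x * h (x /\<^sub>R norm x) \<ge> 0" for x :: 'a
      using nonneg[OF normalize_in_sphere, of x] shell_weight_nonneg[of x]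
      by (cases "x = 0") auto
    then show ?thesis
      using zero integral_nonneg_eq_0_iff_AE[OF integrable_sphere_int[OF cont]]
      unfolding sphere_int_def by simp
  qed
  moreover have "shell_weight x * h (x /\<^sub>R norm x) \<noteq> 0" if "x \<in> U" for x
  proof -
    have "1 < (norm x)\<^sup>2" "(norm x)\<^sup>2 < 2\<^sup>2"
      using that one_less_power[of "norm x" 2] power_strict_mono[of "norm x" 2 2] by (auto simp: U_def)
    then have "bump (x \<bullet> x) > 0"
      by (intro bump_pos) (auto simp: dot_square_norm)
    then show ?thesis using that by (auto simp: U_def shell_weight_def)
  qed
  ultimately have "AE x in lborel. x \<notin> U"
    by (auto elim!: eventually_mono)
  then have "U \<in> null_sets lborel"
    using \<open>open U\<close> by (subst AE_iff_null_sets[of U lborel]) auto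
  then have "ball ((3/2) *\<^sub>R y) r \<in> null_sets lborel"
    by (rule null_sets_subset) (use r in auto)
  then have "measure lborel (ball ((3/2) *\<^sub>R y) r) = 0"
    by (rule measure_eq_0_null_sets)
  then show False using content_ball_pos[OF r(1)] by (metis less_irrefl)
qed

text \<open>Gram-Schmidt. If \<open>z\<close> vanishes on the sphere, the coefficient \<open>t\<close> is \<open>0\<close> because \<open>x / 0 = 0\<close>.\<close>

lemma projection_exists:
  fixes y :: "'i \<Rightarrow> 'a::euclidean_space \<Rightarrow> real"
  assumes "finite M" and "continuous_on (sphere 0 1) f"
    and "\<And>i. i \<in> M \<Longrightarrow> continuous_on (sphere 0 1) (y i)"
  shows "\<exists>c. \<forall>j\<in>M. sphere_int (\<lambda>x. (f x - (\<Sum>i\<in>M. c i * y i x)) * y j x) = 0"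
  using assms
proof (induction M arbitrary: f rule: finite_induct)
  case empty
  then show ?case by simp
next
  case (insert a M)
  have cy: "continuous_on (sphere 0 1) (y i)" if "i \<in> insert a M" for i
    using insert.prems that by blast
  obtain c where c: "\<forall>j\<in>M. sphere_int (\<lambda>x. (f x - (\<Sum>i\<in>M. c i * y i x)) * y j x) = 0"
    using insert.IH[OF insert.prems(1)] cy by auto
  \<comment> \<open>The induction hypothesis holds for every continuous function, so it also
    projects the new function \<open>y a\<close>; \<open>z\<close> below is the part of
    \<open>y a\<close> orthogonal to the old ones.\<close>
  obtain d where d: "\<forall>j\<in>M. sphere_int (\<lambda>x. (y a x - (\<Sum>i\<in>M. d i * y i x)) * y j x) = 0"
    using insert.IH[of "y a"] cy by auto
  define f' where "f' x = f x - (\<Sum>i\<in>M. c i * y i x)" for x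
  define z where "z x = y a x - (\<Sum>i\<in>M. d i * y i x)" for x
  have cf: "continuous_on (sphere 0 1) f'" and cz: "continuous_on (sphere 0 1) z"
    unfolding f'_def z_def by (intro continuous_intros insert.prems cy; simp)+
  define t where "t = sphere_int (\<lambda>x. f' x * z x) / sphere_int (\<lambda>x. z x * z x)"
  define g where "g x = f' x - t * z x" for x
  have cg: "continuous_on (sphere 0 1) g"
    unfolding g_def by (intro continuous_intros cf cz)
  have split: "sphere_int (\<lambda>x. g x * w x) = sphere_int (\<lambda>x. f' x * w x) - t * sphere_int (\<lambda>x. z x * w x)"
    if "continuous_on (sphere 0 1) w" for w
  proof -
    have "sphere_int (\<lambda>x. g x * w x) = sphere_int (\<lambda>x. f' x * w x - t * (z x * w x))"
      by (simp add: g_def algebra_simps)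
    also have "\<dots> = sphere_int (\<lambda>x. f' x * w x) - sphere_int (\<lambda>x. t * (z x * w x))"
      by (rule sphere_int_diff) (intro continuous_intros cf cz that)+
    finally show ?thesis by (simp add: sphere_int_cmult)
  qed
  have gM: "sphere_int (\<lambda>x. g x * y j x) = 0" if "j \<in> M" for j
    using split[of "y j"] cy[of j] c d that by (simp add: f'_def z_def)
  have gz: "sphere_int (\<lambda>x. g x * z x) = 0"
  proof (cases "sphere_int (\<lambda>x. z x * z x) = 0")
    case True
    have "z x = 0" if "x \<in> sphere 0 1" for x
      using sphere_int_eq_0_imp[of "\<lambda>x. z x * z x", OF _ _ True that] cz
      by (simp add: continuous_on_mult)
    then have "sphere_int (\<lambda>x. g x * z x) = sphere_int (\<lambda>x. 0 * z x)"
      by (intro sphere_int_cong) simp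
    then show ?thesis by (simp add: sphere_int_def)
  next
    case False
    then show ?thesis using split[OF cz] by (simp add: t_def)
  qed
  \<comment> \<open>Orthogonality passes to linear combinations by induction on the index set. Since
    \<open>y a\<close> is \<open>z\<close> plus such a combination, \<open>g\<close> is then
    orthogonal to \<open>y a\<close>.\<close>
  have "sphere_int (\<lambda>x. g x * (\<Sum>i\<in>A. d i * y i x)) = (\<Sum>i\<in>A. d i * sphere_int (\<lambda>x. g x * y i x))"
    if "finite A" "A \<subseteq> M" for A
    using that
  proof (induction A rule: finite_induct)
    case empty
    then show ?case by (simp add: sphere_int_def)
  next
    case (insert b A)
    have "sphere_int (\<lambda>x. g x * (\<Sum>i\<in>insert b A. d i * y i x))
        = sphere_int (\<lambda>x. d b * (g x * y b x) + g x * (\<Sum>i\<in>A. d i * y i x))"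
      using insert.hyps by (simp add: algebra_simps)
    also have "\<dots> = sphere_int (\<lambda>x. d b * (g x * y b x)) + sphere_int (\<lambda>x. g x * (\<Sum>i\<in>A. d i * y i x))"
      by (rule sphere_int_add) (intro continuous_intros cg cy; use insert.prems in auto)+
    finally show ?case using insert by (simp add: sphere_int_cmult)
  qed
  from this[of M] have "sphere_int (\<lambda>x. g x * (\<Sum>i\<in>M. d i * y i x)) = 0"
    using gM insert.hyps by simp
  moreover have "sphere_int (\<lambda>x. g x * y a x)
      = sphere_int (\<lambda>x. g x * z x) + sphere_int (\<lambda>x. g x * (\<Sum>i\<in>M. d i * y i x))"
    by (subst sphere_int_add[symmetric])
       (intro continuous_intros cg cy cz; auto | simp add: z_def algebra_simps)+
  ultimately have ga: "sphere_int (\<lambda>x. g x * y a x) = 0" using gz by simp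
  \<comment> \<open>Coefficients read off from \<open>f' - t z\<close> after expanding
    \<open>z\<close> as \<open>y a\<close> minus its projection.\<close>
  define e where "e i = (if i = a then t else c i - t * d i)" for i
  have "g x = f x - (\<Sum>i\<in>insert a M. e i * y i x)" for x
  proof -
    have "(\<Sum>i\<in>M. e i * y i x) = (\<Sum>i\<in>M. c i * y i x) - t * (\<Sum>i\<in>M. d i * y i x)"
      unfolding sum_distrib_left sum_subtractf[symmetric]
      by (rule sum.cong) (use insert.hyps in \<open>auto simp: e_def algebra_simps\<close>)
    then show ?thesis
      using insert.hyps by (simp add: g_def f'_def z_def e_def algebra_simps)
  qed
  then show ?case using ga gM by (intro exI[of _ e]) auto
qed

text \<open>On the sphere, the Euclidean Laplacian of the extension of \<open>f\<close> constant along rays is the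
  Laplace-Beltrami operator. \<open>A\<close> is the gradient of this extension and \<open>A'\<close> its derivative.\<close>

definition eigen_data ::
  "real \<Rightarrow> ('a::euclidean_space \<Rightarrow> real) \<Rightarrow> ('a \<Rightarrow> 'a) \<Rightarrow> ('a \<Rightarrow> 'a \<Rightarrow> 'a) \<Rightarrow> bool" where
  "eigen_data \<mu> f A A' \<longleftrightarrow>
     (\<forall>x. x \<noteq> 0 \<longrightarrow> ((\<lambda>y. f (y /\<^sub>R norm y)) has_derivative (\<lambda>h. A x \<bullet> h)) (at x)) \<and>
     (\<forall>x. x \<noteq> 0 \<longrightarrow> (A has_derivative A' x) (at x)) \<and>
     (\<forall>e. continuous_on (- {0}) (\<lambda>x. A' x e)) \<and>
     (\<forall>x. x \<noteq> 0 \<longrightarrow> (\<Sum>i\<in>Basis. A' x i \<bullet> i) = - \<mu> * f (x /\<^sub>R norm x) / (x \<bullet> x))"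

definition eigenfunction :: "real \<Rightarrow> ('a::euclidean_space \<Rightarrow> real) \<Rightarrow> bool" where
  "eigenfunction \<mu> f \<longleftrightarrow> (\<exists>A A'. eigen_data \<mu> f A A')"

lemma eigen_dataD:
  assumes "eigen_data \<mu> f A A'"
  shows "x \<noteq> 0 \<Longrightarrow> ((\<lambda>y. f (y /\<^sub>R norm y)) has_derivative (\<lambda>h. A x \<bullet> h)) (at x)"
    and "x \<noteq> 0 \<Longrightarrow> (A has_derivative A' x) (at x)"
    and "continuous_on (- {0}) (\<lambda>x. A' x e)"
    and "x \<noteq> 0 \<Longrightarrow> (\<Sum>i\<in>Basis. A' x i \<bullet> i) = - \<mu> * f (x /\<^sub>R norm x) / (x \<bullet> x)"
  using assms unfolding eigen_data_def by blast+

text \<open>The extension is constant along the ray through \<open>x\<close>; differentiating along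
  it at \<open>t = 1\<close> gives the claim.\<close>

lemma radial_derivative_eq_0:
  fixes x :: "'a::real_inner"
  assumes "((\<lambda>y. f (y /\<^sub>R norm y)) has_derivative (\<lambda>h. a \<bullet> h)) (at x)" and "x \<noteq> 0"
  shows "a \<bullet> x = (0::real)"
proof -
  have 1: "((\<lambda>t. t *\<^sub>R x) has_derivative (\<lambda>t. t *\<^sub>R x)) (at (1::real))"
    by (auto intro!: derivative_eq_intros)
  have "((\<lambda>y. f (y /\<^sub>R norm y)) has_derivative (\<lambda>h. a \<bullet> h)) (at (1 *\<^sub>R x))"
    using assms(1) by simp
  from has_derivative_compose[OF 1 this]
  have "((\<lambda>t. f ((t *\<^sub>R x) /\<^sub>R norm (t *\<^sub>R x))) has_derivative (\<lambda>t. a \<bullet> (t *\<^sub>R x))) (at (1::real))" .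
  then have "((\<lambda>t. f (x /\<^sub>R norm x)) has_derivative (\<lambda>t. a \<bullet> (t *\<^sub>R x))) (at (1::real))"
    by (rule has_derivative_transform_within_open[where s = "{0<..}"]) (auto simp: field_simps)
  moreover have "((\<lambda>t. f (x /\<^sub>R norm x)) has_derivative (\<lambda>t. 0)) (at (1::real))" by simp
  ultimately have "(\<lambda>t::real. a \<bullet> (t *\<^sub>R x)) = (\<lambda>t. 0)"
    by (rule has_derivative_unique)
  from fun_cong[OF this, of 1] show ?thesis by simp
qed

lemma eigenfunction_continuous:
  assumes "eigenfunction \<mu> f"
  shows "continuous_on (sphere 0 1) f"
proof -
  obtain A A' where "eigen_data \<mu> f A A'"
    using assms unfolding eigenfunction_def by blast
  note A = eigen_dataD[OF this]
  have "continuous_on (sphere 0 1) (\<lambda>y. f (y /\<^sub>R norm y))"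
  proof (rule continuous_at_imp_continuous_on, rule ballI)
    fix x :: 'a
    assume "x \<in> sphere 0 1"
    then have "x \<noteq> 0" by auto
    then show "isCont (\<lambda>y. f (y /\<^sub>R norm y)) x" using has_derivative_continuous[OF A(1)] by blast
  qed
  then show ?thesis by (rule continuous_on_eq) simp
qed

lemma eigenfunction_add:
  assumes "eigenfunction \<mu> f" "eigenfunction \<mu> g"
  shows "eigenfunction \<mu> (\<lambda>x. f x + g x)"
proof -
  obtain A A' B B' where "eigen_data \<mu> f A A'" "eigen_data \<mu> g B B'"
    using assms unfolding eigenfunction_def by blast
  note AB = eigen_dataD[OF this(1)] eigen_dataD[OF this(2)]
  have "((\<lambda>y. f (y /\<^sub>R norm y) + g (y /\<^sub>R norm y)) has_derivative (\<lambda>h. (A x + B x) \<bullet> h)) (at x)"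
    if "x \<noteq> 0" for x
    by (rule has_derivative_eq_rhs[OF has_derivative_add[OF AB(1) AB(5)]])
       (use that in \<open>auto simp: fun_eq_iff inner_add_left\<close>)
  moreover have "((\<lambda>x. A x + B x) has_derivative (\<lambda>h. A' x h + B' x h)) (at x)" if "x \<noteq> 0" for x
    by (intro has_derivative_add AB that)
  moreover have "continuous_on (- {0}) (\<lambda>x. A' x e + B' x e)" for e
    by (intro continuous_intros AB)
  moreover have "(\<Sum>i\<in>Basis. (A' x i + B' x i) \<bullet> i)
      = - \<mu> * (f (x /\<^sub>R norm x) + g (x /\<^sub>R norm x)) / (x \<bullet> x)" if "x \<noteq> 0" for x
    using AB(4)[OF that] AB(8)[OF that]
    by (simp add: inner_add_left sum.distrib distrib_left add_divide_distrib diff_divide_distrib)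
  ultimately have "eigen_data \<mu> (\<lambda>x. f x + g x) (\<lambda>x. A x + B x) (\<lambda>x h. A' x h + B' x h)"
    unfolding eigen_data_def by blast
  then show ?thesis unfolding eigenfunction_def by blast
qed

lemma eigenfunction_cmult:
  assumes "eigenfunction \<mu> f"
  shows "eigenfunction \<mu> (\<lambda>x. c * f x)"
proof -
  obtain A A' where "eigen_data \<mu> f A A'"
    using assms unfolding eigenfunction_def by blast
  note A = eigen_dataD[OF this]
  have "((\<lambda>y. c * f (y /\<^sub>R norm y)) has_derivative (\<lambda>h. (c *\<^sub>R A x) \<bullet> h)) (at x)"
    if "x \<noteq> 0" for x
    by (rule has_derivative_eq_rhs[OF has_derivative_mult_right[OF A(1)]])
       (use that in \<open>auto simp: fun_eq_iff\<close>)
  moreover have "((\<lambda>x. c *\<^sub>R A x) has_derivative (\<lambda>h. c *\<^sub>R A' x h)) (at x)" if "x \<noteq> 0" for x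
    by (intro has_derivative_scaleR_right A that)
  moreover have "continuous_on (- {0}) (\<lambda>x. c *\<^sub>R A' x e)" for e
    by (intro continuous_intros A)
  moreover have "(\<Sum>i\<in>Basis. (c *\<^sub>R A' x i) \<bullet> i) = - \<mu> * (c * f (x /\<^sub>R norm x)) / (x \<bullet> x)"
    if "x \<noteq> 0" for x
    using A(4)[OF that] by (simp add: sum_distrib_left[symmetric])
  ultimately have "eigen_data \<mu> (\<lambda>x. c * f x) (\<lambda>x. c *\<^sub>R A x) (\<lambda>x h. c *\<^sub>R A' x h)"
    unfolding eigen_data_def by blast
  then show ?thesis unfolding eigenfunction_def by blast
qed

lemma eigenfunction_diff_sum:
  assumes "finite M" "\<And>i. i \<in> M \<Longrightarrow> eigenfunction \<mu> (y i)" "eigenfunction \<mu> f"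
  shows "eigenfunction \<mu> (\<lambda>x. f x - (\<Sum>i\<in>M. c i * y i x))"
  using assms
proof (induction M rule: finite_induct)
  case (insert a M)
  then have "eigenfunction \<mu> (\<lambda>x. (f x - (\<Sum>i\<in>M. c i * y i x)) + (- c a) * y a x)"
    by (intro eigenfunction_add eigenfunction_cmult) auto
  moreover have "(\<lambda>x. (f x - (\<Sum>i\<in>M. c i * y i x)) + (- c a) * y a x)
      = (\<lambda>x. f x - (\<Sum>i\<in>insert a M. c i * y i x))"
    using insert.hyps by (simp add: fun_eq_iff)
  ultimately show ?case by simp
qed simp

text \<open>The divergence identity is applied to the gradient of \<open>f\<close> weighted by
  \<open>g\<close> and conversely. In the difference the products of the gradients cancel, and the
  two Laplacians leave \<nu> - \<mu> times the integral of \<open>f g\<close>.\<close>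

lemma eigenfunctions_orthogonal:
  assumes "eigenfunction \<mu> f" "eigenfunction \<nu> g" "\<mu> \<noteq> \<nu>"
  shows "sphere_int (\<lambda>x. f x * g x) = 0"
proof -
  obtain A A' B B' where "eigen_data \<mu> f A A'" "eigen_data \<nu> g B B'"
    using assms unfolding eigenfunction_def by blast
  note AB = eigen_dataD[OF this(1)] eigen_dataD[OF this(2)]
  have cA: "continuous_on (- {0}) A" and cB: "continuous_on (- {0}) B"
    by (rule continuous_at_imp_continuous_on, auto intro: has_derivative_continuous[OF AB(2)] has_derivative_continuous[OF AB(6)])+
  note 1 = bump_divergence_integral[of A A' "\<lambda>y. g (y /\<^sub>R norm y)" B,
      OF AB(2,3) radial_derivative_eq_0[OF AB(1)] AB(5) cB]
  note 2 = bump_divergence_integral[of B B' "\<lambda>y. f (y /\<^sub>R norm y)" A,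
      OF AB(6,7) radial_derivative_eq_0[OF AB(5)] AB(1) cA]
  have "(\<nu> - \<mu>) * sphere_int (\<lambda>x. f x * g x) = sphere_int (\<lambda>x. (\<nu> - \<mu>) * (f x * g x))"
    by (rule sphere_int_cmult[symmetric])
  also have "\<dots> = (\<integral>x. bump (x \<bullet> x) * (g (x /\<^sub>R norm x) * (\<Sum>i\<in>Basis. A' x i \<bullet> i) + A x \<bullet> B x)
           - bump (x \<bullet> x) * (f (x /\<^sub>R norm x) * (\<Sum>i\<in>Basis. B' x i \<bullet> i) + B x \<bullet> A x) \<partial>lborel)"
    unfolding sphere_int_def
  proof (rule Bochner_Integration.integral_cong)
    fix x :: 'a
    show "shell_weight x * ((\<nu> - \<mu>) * (f (x /\<^sub>R norm x) * g (x /\<^sub>R norm x)))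
      = bump (x \<bullet> x) * (g (x /\<^sub>R norm x) * (\<Sum>i\<in>Basis. A' x i \<bullet> i) + A x \<bullet> B x)
           - bump (x \<bullet> x) * (f (x /\<^sub>R norm x) * (\<Sum>i\<in>Basis. B' x i \<bullet> i) + B x \<bullet> A x)"
    proof (cases "x = 0")
      case True
      then show ?thesis by (simp add: bump_eq_0)
    next
      case False
      then show ?thesis
        unfolding AB(4)[OF False] AB(8)[OF False] inner_commute[of "B x" "A x"] shell_weight_def
        by (simp add: divide_simps) (simp add: algebra_simps)
    qed
  qed simp
  also have "\<dots> = 0"
    by (subst Bochner_Integration.integral_diff) (use 1 2 in auto)
  finally show ?thesis using assms(3) by simp
qed

section \<open>Spherical harmonics are eigenfunctions\<close>

lemma Basis_vec3: "(Basis :: (real^3) set) = {axis 1 1, axis 2 1, axis 3 1}"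
  by (auto simp: Basis_vec_def) (metis exhaust_3)

lemma sum_Basis_vec3: "(\<Sum>i\<in>(Basis :: (real^3) set). g i) = g (axis 1 1) + g (axis 2 1) + g (axis 3 1)"
  unfolding Basis_vec3 by (simp add: axis_eq_axis add.assoc)

text \<open>Gradient and Laplacian are explicit parameters, so that the rules below compute them for
  composite functions; the derivative of the gradient stays hidden because only its trace
  matters.\<close>

definition lap_data :: "(real^3 \<Rightarrow> real) \<Rightarrow> (real^3 \<Rightarrow> real^3) \<Rightarrow> (real^3 \<Rightarrow> real) \<Rightarrow> bool" where
  "lap_data F A l \<longleftrightarrow> (\<exists>A'.
     (\<forall>x. x \<noteq> 0 \<longrightarrow> (F has_derivative (\<lambda>h. A x \<bullet> h)) (at x)) \<and>
     (\<forall>x. x \<noteq> 0 \<longrightarrow> (A has_derivative A' x) (at x)) \<and>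
     (\<forall>e. continuous_on (- {0}) (\<lambda>x. A' x e)) \<and>
     (\<forall>x. x \<noteq> 0 \<longrightarrow> (\<Sum>i\<in>Basis. A' x i \<bullet> i) = l x))"

lemma lap_dataI:
  assumes "\<And>x. x \<noteq> 0 \<Longrightarrow> (F has_derivative (\<lambda>h. A x \<bullet> h)) (at x)"
    and "\<And>x. x \<noteq> 0 \<Longrightarrow> (A has_derivative A' x) (at x)"
    and "\<And>e. continuous_on (- {0}) (\<lambda>x. A' x e)"
    and "\<And>x. x \<noteq> 0 \<Longrightarrow> (\<Sum>i\<in>Basis. A' x i \<bullet> i) = l x"
  shows "lap_data F A l"
  using assms unfolding lap_data_def by (intro exI[of _ A'] conjI allI impI)

lemma lap_dataE:
  assumes "lap_data F A l"
  obtains A' where "\<And>x. x \<noteq> 0 \<Longrightarrow> (F has_derivative (\<lambda>h. A x \<bullet> h)) (at x)"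
    and "\<And>x. x \<noteq> 0 \<Longrightarrow> (A has_derivative A' x) (at x)"
    and "\<And>e. continuous_on (- {0}) (\<lambda>x. A' x e)"
    and "\<And>x. x \<noteq> 0 \<Longrightarrow> (\<Sum>i\<in>Basis. A' x i \<bullet> i) = l x"
    and "continuous_on (- {0}) F" and "continuous_on (- {0}) A"
proof -
  obtain A' where A': "\<forall>x. x \<noteq> 0 \<longrightarrow> (F has_derivative (\<lambda>h. A x \<bullet> h)) (at x)"
     "\<forall>x. x \<noteq> 0 \<longrightarrow> (A has_derivative A' x) (at x)"
     "\<forall>e. continuous_on (- {0}) (\<lambda>x. A' x e)"
     "\<forall>x. x \<noteq> 0 \<longrightarrow> (\<Sum>i\<in>Basis. A' x i \<bullet> i) = l x"
    using assms unfolding lap_data_def by (elim exE conjE)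
  have "isCont F x" "isCont A x" if "x \<noteq> 0" for x
    using has_derivative_continuous[of F _ x UNIV] has_derivative_continuous[of A _ x UNIV] A'(1,2) that by auto
  then have "continuous_on (- {0}) F" "continuous_on (- {0}) A"
    by (auto intro!: continuous_at_imp_continuous_on)
  with A' show thesis by (intro that[of A']) auto
qed

lemma lap_data_inner: "lap_data (\<lambda>x. b \<bullet> x) (\<lambda>x. b) (\<lambda>x. 0)"
  by (rule lap_dataI[of _ _ "\<lambda>x h. 0"]) (auto intro!: derivative_eq_intros)

lemma lap_data_mult:
  assumes "lap_data F A l" "lap_data G B m"
  shows "lap_data (\<lambda>x. F x * G x) (\<lambda>x. F x *\<^sub>R B x + G x *\<^sub>R A x)
           (\<lambda>x. F x * m x + G x * l x + 2 * (A x \<bullet> B x))"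
proof -
  obtain A' where A: "\<And>x. x \<noteq> 0 \<Longrightarrow> (F has_derivative (\<lambda>h. A x \<bullet> h)) (at x)"
    "\<And>x. x \<noteq> 0 \<Longrightarrow> (A has_derivative A' x) (at x)"
    "\<And>e. continuous_on (- {0}) (\<lambda>x. A' x e)"
    "\<And>x. x \<noteq> 0 \<Longrightarrow> (\<Sum>i\<in>Basis. A' x i \<bullet> i) = l x"
    "continuous_on (- {0}) F" "continuous_on (- {0}) A"
    using assms(1) by (rule lap_dataE) (rule that; assumption)
  obtain B' where B: "\<And>x. x \<noteq> 0 \<Longrightarrow> (G has_derivative (\<lambda>h. B x \<bullet> h)) (at x)"
    "\<And>x. x \<noteq> 0 \<Longrightarrow> (B has_derivative B' x) (at x)"
    "\<And>e. continuous_on (- {0}) (\<lambda>x. B' x e)"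
    "\<And>x. x \<noteq> 0 \<Longrightarrow> (\<Sum>i\<in>Basis. B' x i \<bullet> i) = m x"
    "continuous_on (- {0}) G" "continuous_on (- {0}) B"
    using assms(2) by (rule lap_dataE) (rule that; assumption)
  show ?thesis
  proof (rule lap_dataI[where A' = "\<lambda>x h. (F x *\<^sub>R B' x h + (A x \<bullet> h) *\<^sub>R B x)
      + (G x *\<^sub>R A' x h + (B x \<bullet> h) *\<^sub>R A x)"])
    fix x :: "real^3" assume x: "x \<noteq> 0"
    show "((\<lambda>x. F x * G x) has_derivative (\<lambda>h. (F x *\<^sub>R B x + G x *\<^sub>R A x) \<bullet> h)) (at x)"
      by (rule has_derivative_eq_rhs[OF has_derivative_mult[OF A(1)[OF x] B(1)[OF x]]])
         (simp add: fun_eq_iff inner_add_left)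
    show "((\<lambda>x. F x *\<^sub>R B x + G x *\<^sub>R A x) has_derivative
         (\<lambda>h. (F x *\<^sub>R B' x h + (A x \<bullet> h) *\<^sub>R B x) + (G x *\<^sub>R A' x h + (B x \<bullet> h) *\<^sub>R A x))) (at x)"
      by (intro has_derivative_add has_derivative_scaleR A(1,2) B(1,2) x)
    have "(\<Sum>i\<in>Basis. ((F x *\<^sub>R B' x i + (A x \<bullet> i) *\<^sub>R B x) + (G x *\<^sub>R A' x i + (B x \<bullet> i) *\<^sub>R A x)) \<bullet> i)
        = F x * (\<Sum>i\<in>Basis. B' x i \<bullet> i) + (\<Sum>i\<in>Basis. (A x \<bullet> i) * (B x \<bullet> i))
          + (G x * (\<Sum>i\<in>Basis. A' x i \<bullet> i) + (\<Sum>i\<in>Basis. (A x \<bullet> i) * (B x \<bullet> i)))"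
      by (simp add: inner_add_left sum.distrib sum_distrib_left mult.commute[of "B x \<bullet> _"])
    then show "(\<Sum>i\<in>Basis. ((F x *\<^sub>R B' x i + (A x \<bullet> i) *\<^sub>R B x) + (G x *\<^sub>R A' x i + (B x \<bullet> i) *\<^sub>R A x)) \<bullet> i)
        = F x * m x + G x * l x + 2 * (A x \<bullet> B x)"
      using A(4)[OF x] B(4)[OF x] by (simp add: euclidean_inner[symmetric])
  qed (intro continuous_intros A B)
qed

lemma lap_data_poly:
  assumes "lap_data F A l"
  shows "lap_data (\<lambda>x. poly q (F x)) (\<lambda>x. poly (pderiv q) (F x) *\<^sub>R A x)
           (\<lambda>x. poly (pderiv (pderiv q)) (F x) * (A x \<bullet> A x) + poly (pderiv q) (F x) * l x)"
proof -
  obtain A' where A: "\<And>x. x \<noteq> 0 \<Longrightarrow> (F has_derivative (\<lambda>h. A x \<bullet> h)) (at x)"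
    "\<And>x. x \<noteq> 0 \<Longrightarrow> (A has_derivative A' x) (at x)"
    "\<And>e. continuous_on (- {0}) (\<lambda>x. A' x e)"
    "\<And>x. x \<noteq> 0 \<Longrightarrow> (\<Sum>i\<in>Basis. A' x i \<bullet> i) = l x"
    "continuous_on (- {0}) F" "continuous_on (- {0}) A"
    using assms by (rule lap_dataE) (rule that; assumption)
  have comp: "((\<lambda>x. poly r (F x)) has_derivative (\<lambda>h. poly (pderiv r) (F x) * (A x \<bullet> h))) (at x)"
    if "x \<noteq> 0" for r x
    using has_derivative_compose[OF A(1)[OF that] poly_DERIV[of r "F x", unfolded has_field_derivative_def]] .
  show ?thesis
  proof (rule lap_dataI[where A' = "\<lambda>x h. poly (pderiv q) (F x) *\<^sub>R A' x h
      + (poly (pderiv (pderiv q)) (F x) * (A x \<bullet> h)) *\<^sub>R A x"])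
    fix x :: "real^3" assume x: "x \<noteq> 0"
    show "((\<lambda>x. poly q (F x)) has_derivative (\<lambda>h. (poly (pderiv q) (F x) *\<^sub>R A x) \<bullet> h)) (at x)"
      by (rule has_derivative_eq_rhs[OF comp[OF x]]) (simp add: fun_eq_iff)
    show "((\<lambda>x. poly (pderiv q) (F x) *\<^sub>R A x) has_derivative
         (\<lambda>h. poly (pderiv q) (F x) *\<^sub>R A' x h + (poly (pderiv (pderiv q)) (F x) * (A x \<bullet> h)) *\<^sub>R A x)) (at x)"
      by (intro has_derivative_scaleR comp A(1,2) x)
    have "(\<Sum>i\<in>Basis. (poly (pderiv q) (F x) *\<^sub>R A' x i + (poly (pderiv (pderiv q)) (F x) * (A x \<bullet> i)) *\<^sub>R A x) \<bullet> i)
        = poly (pderiv q) (F x) * (\<Sum>i\<in>Basis. A' x i \<bullet> i)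
          + poly (pderiv (pderiv q)) (F x) * (\<Sum>i\<in>Basis. (A x \<bullet> i) * (A x \<bullet> i))"
      by (simp add: inner_add_left sum.distrib sum_distrib_left mult.assoc)
    then show "(\<Sum>i\<in>Basis. (poly (pderiv q) (F x) *\<^sub>R A' x i + (poly (pderiv (pderiv q)) (F x) * (A x \<bullet> i)) *\<^sub>R A x) \<bullet> i)
        = poly (pderiv (pderiv q)) (F x) * (A x \<bullet> A x) + poly (pderiv q) (F x) * l x"
      using A(4)[OF x] by (simp add: euclidean_inner[symmetric])
  qed (intro continuous_intros A)
qed

lemma has_derivative_inverse_norm_power:
  fixes x :: "'a::real_inner"
  assumes "x \<noteq> 0"
  shows "((\<lambda>x. inverse (norm x) ^ k) has_derivative
     (\<lambda>h. - (real k * inverse (norm x) ^ (k + 2) * (x \<bullet> h)))) (at x)"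
proof -
  have "((\<lambda>x. inverse (norm x)) has_derivative (\<lambda>h. - (inverse (norm x) * (h \<bullet> sgn x) * inverse (norm x)))) (at x)"
    by (rule Deriv.has_derivative_inverse) (use has_derivative_norm[OF assms] assms in auto)
  from has_derivative_power[OF this, of k] show ?thesis
    by (rule has_derivative_eq_rhs)
       (cases k; simp add: fun_eq_iff sgn_div_norm divide_inverse inner_commute power_add power2_eq_square)
qed

text \<open>The factor is k(k + 2) - 3k: the first term comes from differentiating the power of the
  norm, the 3 from the divergence of \<open>x\<close> in dimension three.\<close>

lemma lap_data_inverse_norm_power:
  "lap_data (\<lambda>x. inverse (norm x) ^ k) (\<lambda>x. - (real k * inverse (norm x) ^ (k + 2)) *\<^sub>R x)
     (\<lambda>x. real k * (real k - 1) * inverse (norm x) ^ (k + 2))"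
proof (rule lap_dataI[where A' = "\<lambda>x h. - (real k * inverse (norm x) ^ (k + 2)) *\<^sub>R h
     + (- (real k * (- (real (k + 2) * inverse (norm x) ^ (k + 2 + 2) * (x \<bullet> h))))) *\<^sub>R x"])
  fix x :: "real^3" assume x: "x \<noteq> 0"
  show "((\<lambda>x. inverse (norm x) ^ k) has_derivative (\<lambda>h. (- (real k * inverse (norm x) ^ (k + 2)) *\<^sub>R x) \<bullet> h)) (at x)"
    by (rule has_derivative_eq_rhs[OF has_derivative_inverse_norm_power[OF x]]) (simp add: fun_eq_iff)
  show "((\<lambda>x. - (real k * inverse (norm x) ^ (k + 2)) *\<^sub>R x) has_derivative
     (\<lambda>h. - (real k * inverse (norm x) ^ (k + 2)) *\<^sub>R h
     + (- (real k * (- (real (k + 2) * inverse (norm x) ^ (k + 2 + 2) * (x \<bullet> h))))) *\<^sub>R x)) (at x)"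
    by (intro has_derivative_scaleR has_derivative_minus has_derivative_mult_right
        has_derivative_inverse_norm_power x has_derivative_ident)
  have "(\<Sum>i\<in>Basis. (x \<bullet> i) * (x \<bullet> i)) * inverse (norm x) ^ (k + 2 + 2) = inverse (norm x) ^ (k + 2)"
    using x by (simp add: euclidean_inner[symmetric] dot_square_norm field_simps power2_eq_square)
  moreover have "(\<Sum>i\<in>Basis. (- (real k * inverse (norm x) ^ (k + 2)) *\<^sub>R i
     + (- (real k * (- (real (k + 2) * inverse (norm x) ^ (k + 2 + 2) * (x \<bullet> i))))) *\<^sub>R x) \<bullet> i)
     = - 3 * (real k * inverse (norm x) ^ (k + 2))
      + real k * real (k + 2) * ((\<Sum>i\<in>Basis. (x \<bullet> i) * (x \<bullet> i)) * inverse (norm x) ^ (k + 2 + 2))"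
    unfolding sum_Basis_vec3 by (simp add: inner_add_left inner_axis_axis algebra_simps del: power_Suc)
  ultimately show "(\<Sum>i\<in>Basis. (- (real k * inverse (norm x) ^ (k + 2)) *\<^sub>R i
     + (- (real k * (- (real (k + 2) * inverse (norm x) ^ (k + 2 + 2) * (x \<bullet> i))))) *\<^sub>R x) \<bullet> i)
     = real k * (real k - 1) * inverse (norm x) ^ (k + 2)"
    by (simp only:) (simp add: algebra_simps)
qed (intro continuous_intros; simp)

definition horiz :: "real^3 \<Rightarrow> complex" where
  "horiz x = Complex (x $ 1) (x $ 2)"

lemma horiz_alt: "horiz x = of_real (x $ 1) + \<i> * of_real (x $ 2)"
  by (simp add: horiz_def complex_eq_iff)

lemma horiz_axis: "horiz (axis 1 1) = 1" "horiz (axis 2 1) = \<i>" "horiz (axis 3 1) = 0"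
  by (simp_all add: horiz_def axis_def complex_eq_iff)

lemma has_derivative_Re_horiz_power:
  "((\<lambda>x. Re (z * horiz x ^ k)) has_derivative
     (\<lambda>h. Re (of_nat k * z * horiz x ^ (k - 1) * horiz h))) (at x)"
proof -
  have "(horiz has_derivative horiz) (at x)"
    unfolding horiz_alt[abs_def]
    by (auto intro!: derivative_eq_intros bounded_linear_imp_has_derivative[OF bounded_linear_vec_nth])
  then have "((\<lambda>x. z * horiz x ^ k) has_derivative
     (\<lambda>h. z * (of_nat k * horiz h * horiz x ^ (k - 1)))) (at x)"
    by (intro has_derivative_mult_right has_derivative_power)
  from has_derivative_Re[OF this] show ?thesis
    by (rule has_derivative_eq_rhs) (simp only: mult_ac)
qed

lemma continuous_on_horiz [continuous_intros]: "continuous_on U horiz"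
  unfolding horiz_alt[abs_def] by (intro continuous_intros)

text \<open>The real part of a holomorphic function of the horizontal coordinate is harmonic: the
  second derivatives differ by the factor \<open>\<i>\<close> squared. The truncated
  \<open>k - 1\<close> is harmless at \<open>k = 0\<close> because of the factor
  \<open>of_nat k\<close>. A complex \<open>z\<close> treats real and imaginary parts at
  once.\<close>

lemma lap_data_Re_horiz_power:
  "lap_data (\<lambda>x. Re (z * horiz x ^ k))
     (\<lambda>x. Re (of_nat k * z * horiz x ^ (k - 1)) *\<^sub>R axis 1 1
        + Re (of_nat k * z * \<i> * horiz x ^ (k - 1)) *\<^sub>R axis 2 1) (\<lambda>x. 0)"
proof (rule lap_dataI[where A' = "\<lambda>x h.
    Re (of_nat (k - 1) * (of_nat k * z) * horiz x ^ (k - 1 - 1) * horiz h) *\<^sub>R axis 1 1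
    + Re (of_nat (k - 1) * (of_nat k * z * \<i>) * horiz x ^ (k - 1 - 1) * horiz h) *\<^sub>R axis 2 1"])
  fix x :: "real^3" assume x: "x \<noteq> 0"
  show "((\<lambda>x. Re (z * horiz x ^ k)) has_derivative
     (\<lambda>h. (Re (of_nat k * z * horiz x ^ (k - 1)) *\<^sub>R axis 1 1
        + Re (of_nat k * z * \<i> * horiz x ^ (k - 1)) *\<^sub>R axis 2 1) \<bullet> h)) (at x)"
    by (rule has_derivative_eq_rhs[OF has_derivative_Re_horiz_power])
       (simp add: fun_eq_iff inner_add_left inner_axis' horiz_alt algebra_simps)
  show "((\<lambda>x. Re (of_nat k * z * horiz x ^ (k - 1)) *\<^sub>R axis 1 1
        + Re (of_nat k * z * \<i> * horiz x ^ (k - 1)) *\<^sub>R axis 2 1) has_derivative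
      (\<lambda>h. Re (of_nat (k - 1) * (of_nat k * z) * horiz x ^ (k - 1 - 1) * horiz h) *\<^sub>R axis 1 1
    + Re (of_nat (k - 1) * (of_nat k * z * \<i>) * horiz x ^ (k - 1 - 1) * horiz h) *\<^sub>R axis 2 1)) (at x)"
    by (intro has_derivative_add has_derivative_scaleR_left has_derivative_Re_horiz_power)
  show "(\<Sum>i\<in>Basis. (Re (of_nat (k - 1) * (of_nat k * z) * horiz x ^ (k - 1 - 1) * horiz i) *\<^sub>R axis 1 1
    + Re (of_nat (k - 1) * (of_nat k * z * \<i>) * horiz x ^ (k - 1 - 1) * horiz i) *\<^sub>R axis 2 1) \<bullet> i) = 0"
    unfolding sum_Basis_vec3
    by (simp add: inner_add_left inner_axis_axis horiz_axis)
qed (intro continuous_intros)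


text \<open>Obtained from \<open>(t\<^sup>2 - 1) u' = 2 L t u\<close> by differentiating \<open>j + 1\<close> times.\<close>

lemma pderiv_power_X2_minus_1:
  fixes L :: nat
  defines "u \<equiv> [:- 1, 0, 1::real:] ^ L"
  shows "[:- 1, 0, 1:] * (pderiv ^^ (j + 2)) u + smult (2 * (real j + 1 - real L)) ([:0, 1:] * (pderiv ^^ (j + 1)) u)
     + smult (real j * (real j + 1) - 2 * real L * (real j + 1)) ((pderiv ^^ j) u) = 0"
proof (induction j)
  case 0
  \<comment> \<open>First-order equation for the power; its derivative is the case
    \<open>j = 0\<close>.\<close>
  have u1: "[:- 1, 0, 1:] * pderiv u = smult (2 * real L) ([:0, 1:] * u)"
  proof (cases L)
    case (Suc n)
    define w where "w = [:- 1, 0, 1::real:]"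
    have "pderiv w = smult 2 [:0, 1:]" by (simp add: w_def pderiv_pCons)
    then have "pderiv u = smult (2 * real L) (w ^ n * [:0, 1:])"
      unfolding u_def w_def[symmetric] Suc pderiv_power_Suc by (simp add: mult.commute)
    then show ?thesis
      unfolding u_def w_def[symmetric] Suc by (simp add: mult_ac)
  qed (simp add: u_def)
  define w X where "w = [:- 1, 0, 1::real:]" and "X = [:0, 1::real:]"
  have d: "pderiv w = smult 2 X" "pderiv X = 1"
    by (simp_all add: w_def X_def pderiv_pCons)
  have "pderiv (w * pderiv u) = pderiv (smult (2 * real L) (X * u))"
    unfolding w_def X_def by (simp only: u1)
  then have "w * pderiv (pderiv u) + smult 2 (X * pderiv u) = smult (2 * real L) (X * pderiv u + u)"
    by (simp add: pderiv_mult pderiv_smult d mult.commute)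
  moreover have "(pderiv ^^ (0 + 2)) u = pderiv (pderiv u)" "(pderiv ^^ (0 + 1)) u = pderiv u"
    "(pderiv ^^ 0) u = u"
    by (simp_all add: numeral_2_eq_2)
  ultimately show ?case
    unfolding w_def[symmetric] unfolding X_def[symmetric]
    by (simp add: smult_add_left smult_diff_left smult_add_right algebra_simps)
next
  case (Suc j)
  define a where "a = (pderiv ^^ j) u"
  have e: "(pderiv ^^ (j + 1)) u = pderiv a" "(pderiv ^^ (j + 2)) u = pderiv (pderiv a)"
    "(pderiv ^^ Suc j) u = pderiv a" "(pderiv ^^ (Suc j + 1)) u = pderiv (pderiv a)"
    "(pderiv ^^ (Suc j + 2)) u = pderiv (pderiv (pderiv a))"
    by (simp_all add: a_def numeral_2_eq_2)
  define w X where "w = [:- 1, 0, 1::real:]" and "X = [:0, 1::real:]"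
  have dwX: "pderiv w = smult 2 X" "pderiv X = 1"
    by (simp_all add: w_def X_def pderiv_pCons)
  \<comment> \<open>Differentiating the identity for \<open>j\<close> gives the one for
    \<open>j + 1\<close>; the auxiliary facts \<open>c\<close> and \<open>d\<close> below only
    regroup the scalar factors.\<close>
  have "pderiv (w * pderiv (pderiv a) + smult (2 * (real j + 1 - real L)) (X * pderiv a)
     + smult (real j * (real j + 1) - 2 * real L * (real j + 1)) a) = 0"
    using Suc.IH unfolding e a_def[symmetric] w_def X_def by (simp only: pderiv_0)
  then have *: "w * pderiv (pderiv (pderiv a)) + smult 2 (X * pderiv (pderiv a))
      + smult (2 * (real j + 1 - real L)) (X * pderiv (pderiv a) + pderiv a)
      + smult (real j * (real j + 1) - 2 * real L * (real j + 1)) (pderiv a) = 0"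
    by (simp add: pderiv_add pderiv_mult pderiv_smult dwX mult.commute)
  have c: "smult (2 * (real j + 1 - real L)) b + smult (real j * (real j + 1) - 2 * real L * (real j + 1)) b
     = smult (real (Suc j) * (real (Suc j) + 1) - 2 * real L * (real (Suc j) + 1)) b" for b :: "real poly"
    unfolding smult_add_left[symmetric] by (rule arg_cong[of _ _ "\<lambda>c. smult c b"]) (simp add: algebra_simps)
  have d: "smult 2 b + smult (2 * (real j + 1 - real L)) b = smult (2 * (real (Suc j) + 1 - real L)) b"
    for b :: "real poly"
    unfolding smult_add_left[symmetric] by (rule arg_cong[of _ _ "\<lambda>c. smult c b"]) (simp add: algebra_simps)
  show ?case
    unfolding e c[symmetric] d[symmetric] w_def[symmetric] unfolding X_def[symmetric]
    using * by (simp only: smult_add_right add_ac)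
qed

text \<open>By Rodrigues' formula the k-th derivative of the Legendre polynomial is a multiple of
  the (k + L)-th derivative of (t^2 - 1)^L, so this is the case \<open>j = k + L\<close> of the
  preceding identity with the sign reversed. The zeroth-order factor becomes (k + L + 1)(k - L) =
  k(k + 1) - L(L + 1).\<close>

lemma legendre_derivative_ode:
  fixes t :: real and k L :: nat
  defines "Q \<equiv> (pderiv ^^ k) (legendre L)"
  shows "(1 - t\<^sup>2) * poly (pderiv (pderiv Q)) t - 2 * (real k + 1) * t * poly (pderiv Q) t
     + (real L * (real L + 1) - real k * (real k + 1)) * poly Q t = 0"
proof -
  define u where "u = [:- 1, 0, 1::real:] ^ L"
  define c :: real where "c = 1 / (2 ^ L * fact L)"
  define a where "a = (pderiv ^^ (k + L)) u"
  have Q: "Q = smult c a"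
    by (simp add: Q_def legendre_def higher_pderiv_smult funpow_add a_def u_def c_def)
  have e: "(pderiv ^^ (k + L + 1)) u = pderiv a" "(pderiv ^^ (k + L + 2)) u = pderiv (pderiv a)"
    by (simp_all add: a_def numeral_2_eq_2)
  have "poly ([:- 1, 0, 1:] * pderiv (pderiv a) + smult (2 * (real (k + L) + 1 - real L)) ([:0, 1:] * pderiv a)
     + smult (real (k + L) * (real (k + L) + 1) - 2 * real L * (real (k + L) + 1)) a) t = 0"
    using pderiv_power_X2_minus_1[where j = "k + L" and L = L, folded u_def] unfolding e a_def[symmetric]
    by (simp only: poly_0)
  then have "c * ((t\<^sup>2 - 1) * poly (pderiv (pderiv a)) t + 2 * (real k + 1) * t * poly (pderiv a) t
     - (real L * (real L + 1) - real k * (real k + 1)) * poly a t) = 0"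
    by (simp add: algebra_simps power2_eq_square)
  then show ?thesis
    by (simp add: Q pderiv_smult algebra_simps)
qed


lemma eigenfunction_of_lap_data:
  assumes "lap_data (\<lambda>x. f (x /\<^sub>R norm x)) A l"
    and "\<And>x. x \<noteq> 0 \<Longrightarrow> l x = - \<mu> * f (x /\<^sub>R norm x) / (x \<bullet> x)"
  shows "eigenfunction \<mu> f"
  using assms unfolding lap_data_def eigenfunction_def eigen_data_def by auto

text \<open>Unnormalised spherical harmonics of degree \<open>L\<close> and order \<open>k\<close>.
  The complex factor selects the cosine or the sine variant, and real linearity in \<open>z\<close>
  later reduces a general factor to these two.\<close>

definition harm_product :: "nat \<Rightarrow> nat \<Rightarrow> complex \<Rightarrow> real^3 \<Rightarrow> real" where
  "harm_product L k z x = poly ((pderiv ^^ k) (legendre L)) (x $ 3) * Re (z * horiz x ^ k)"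

text \<open>Separation of variables in Cartesian form: the extension constant along rays is a
  polynomial in \<open>x $ 3\<close> over the norm, times a harmonic homogeneous function divided by
  the k-th power of the norm. The product rule reduces its Laplacian to the differentiated Legendre
  equation.\<close>

lemma eigenfunction_harm_product: "eigenfunction (real L * (real L + 1)) (harm_product L k z)"
proof -
  define Q where "Q = (pderiv ^^ k) (legendre L)"
  define u where "u x = inverse (norm x)" for x :: "real^3"
  define h where "h x = Re (z * horiz x ^ k)" for x
  \<comment> \<open>\<open>S\<close> is the cosine of the polar angle and \<open>AS\<close> its
    gradient; \<open>B\<close> is the gradient of \<open>h\<close>, and \<open>AT\<close> that of
    \<open>h\<close> made homogeneous of degree 0.\<close>
  define S where "S x = (axis 3 1 \<bullet> x) * u x ^ 1" for x :: "real^3"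
  define AS where "AS x = (axis 3 1 \<bullet> x) *\<^sub>R (- (real 1 * u x ^ (1 + 2)) *\<^sub>R x) + u x ^ 1 *\<^sub>R axis 3 1" for x :: "real^3"
  define B where "B x = Re (of_nat k * z * horiz x ^ (k - 1)) *\<^sub>R axis 1 1
        + Re (of_nat k * z * \<i> * horiz x ^ (k - 1)) *\<^sub>R axis (2::3) (1::real)" for x
  define AT where "AT x = h x *\<^sub>R (- (real k * u x ^ (k + 2)) *\<^sub>R x) + u x ^ k *\<^sub>R B x" for x :: "real^3"
  have eq: "(\<lambda>x. harm_product L k z (x /\<^sub>R norm x)) = (\<lambda>x. poly Q (S x) * (h x * u x ^ k))"
  proof
    fix x :: "real^3"
    have "horiz (x /\<^sub>R norm x) = of_real (u x) * horiz x"
      unfolding horiz_alt by (simp add: u_def algebra_simps)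
    then have "Re (z * horiz (x /\<^sub>R norm x) ^ k) = Re (of_real (u x ^ k) * (z * horiz x ^ k))"
      by (simp add: power_mult_distrib mult_ac)
    also have "\<dots> = h x * u x ^ k"
      by (simp only: scaleR_conv_of_real[symmetric] scaleR_complex.sel h_def mult.commute)
    finally show "harm_product L k z (x /\<^sub>R norm x) = poly Q (S x) * (h x * u x ^ k)"
      by (simp add: harm_product_def Q_def S_def u_def inner_axis' mult.commute)
  qed
  have data_S: "lap_data S AS (\<lambda>x. (axis 3 1 \<bullet> x) * (real 1 * (real 1 - 1) * u x ^ (1 + 2)) + u x ^ 1 * 0
      + 2 * (axis 3 1 \<bullet> (- (real 1 * u x ^ (1 + 2)) *\<^sub>R x)))"
    unfolding S_def[abs_def] AS_def[abs_def] u_def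
    by (rule lap_data_mult[OF lap_data_inner lap_data_inverse_norm_power])
  have data_T: "lap_data (\<lambda>x. h x * u x ^ k) AT (\<lambda>x. h x * (real k * (real k - 1) * u x ^ (k + 2)) + u x ^ k * 0
      + 2 * (B x \<bullet> (- (real k * u x ^ (k + 2)) *\<^sub>R x)))"
    unfolding h_def AT_def[abs_def] u_def B_def
    by (rule lap_data_mult[OF lap_data_Re_horiz_power lap_data_inverse_norm_power])
  note data = lap_data_mult[OF lap_data_poly[OF data_S, of Q] data_T]
  show ?thesis
  proof (rule eigenfunction_of_lap_data[OF data[folded eq]])
    fix x :: "real^3" assume x: "x \<noteq> 0"
    define t where "t = x $ 3"
    define R where "R = x \<bullet> x"
    have uR: "(u x)\<^sup>2 * R = 1"
      using x by (simp add: u_def R_def dot_square_norm power_inverse)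
    have R: "R \<noteq> 0" using x by (simp add: R_def)
    have ex: "axis 3 1 \<bullet> x = t" "x \<bullet> axis 3 1 = t"
      by (simp_all add: t_def inner_axis' inner_axis)
    have eB: "axis 3 1 \<bullet> B x = 0"
      by (simp add: B_def inner_add_right inner_axis_axis)
    have xB: "x \<bullet> B x = real k * h x" "B x \<bullet> x = real k * h x"
    proof -
      \<comment> \<open>Euler's relation for \<open>h\<close>, which is homogeneous of degree
        \<open>k\<close>.\<close>
      have "x \<bullet> B x = Re (of_nat k * z * horiz x ^ (k - 1) * horiz x)"
        by (simp add: B_def inner_add_right inner_axis horiz_alt algebra_simps)
      also have "\<dots> = Re (of_nat k * (z * horiz x ^ k))"
        by (cases k) (simp_all add: mult_ac)
      finally show "x \<bullet> B x = real k * h x" by (simp add: h_def)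
      then show "B x \<bullet> x = real k * h x" by (simp add: inner_commute)
    qed
    have ee: "axis 3 1 \<bullet> (axis 3 1 :: real^3) = 1" by (simp add: inner_axis_axis)
    \<comment> \<open>The squared gradient of the cosine supplies the leading coefficient 1 - t^2 of
      the Legendre equation; the mixed product in \<open>2\<close> raises its first-order
      coefficient from 2 to 2(k + 1).\<close>
    have 1: "AS x \<bullet> AS x = (u x)\<^sup>2 * (1 - (t * u x)\<^sup>2)"
    proof -
      have "AS x \<bullet> AS x = t\<^sup>2 * u x ^ 4 * ((u x)\<^sup>2 * R) - 2 * t\<^sup>2 * u x ^ 4 + (u x)\<^sup>2"
        by (simp add: AS_def ex ee inner_add_left inner_add_right inner_diff_left inner_diff_right R_def[symmetric])
           (simp add: algebra_simps power2_eq_square power3_eq_cube power4_eq_xxxx)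
      then show ?thesis unfolding uR by (simp add: algebra_simps power2_eq_square power4_eq_xxxx)
    qed
    have 2: "AS x \<bullet> AT x = - (real k * h x * t * u x ^ (k + 3))"
    proof -
      have "AS x \<bullet> AT x = t * real k * h x * u x ^ (k + 3) * ((u x)\<^sup>2 * R) - 2 * (real k * h x * t * u x ^ (k + 3))"
        by (simp add: AS_def AT_def ex eB xB inner_add_left inner_add_right inner_diff_left inner_diff_right R_def[symmetric])
           (simp add: algebra_simps power2_eq_square power3_eq_cube power_add)
      then show ?thesis unfolding uR by simp
    qed
    define q0 q1 q2 where "q0 = poly Q (t * u x)" and "q1 = poly (pderiv Q) (t * u x)"
      and "q2 = poly (pderiv (pderiv Q)) (t * u x)"
    have ode: "(1 - (t * u x)\<^sup>2) * q2 - 2 * (real k + 1) * (t * u x) * q1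
      + (real L * (real L + 1) - real k * (real k + 1)) * q0 = 0"
      unfolding q0_def q1_def q2_def Q_def by (rule legendre_derivative_ode)
    have Sx: "S x = t * u x" by (simp add: S_def ex)
    have "poly Q (S x) *
          (h x * (real k * (real k - 1) * u x ^ (k + 2)) + u x ^ k * 0 + 2 * (B x \<bullet> (- (real k * u x ^ (k + 2)) *\<^sub>R x))) +
          h x * u x ^ k *
          (poly (pderiv (pderiv Q)) (S x) * (AS x \<bullet> AS x) +
           poly (pderiv Q) (S x) *
           ((axis 3 1 \<bullet> x) * (real 1 * (real 1 - 1) * u x ^ (1 + 2)) + u x ^ 1 * 0 +
            2 * (axis 3 1 \<bullet> (- (real 1 * u x ^ (1 + 2)) *\<^sub>R x)))) +
          2 * (poly (pderiv Q) (S x) *\<^sub>R AS x \<bullet> AT x)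
        = h x * u x ^ (k + 2) * ((1 - (t * u x)\<^sup>2) * q2 - 2 * (real k + 1) * (t * u x) * q1
            - real k * (real k + 1) * q0)"
      unfolding Sx 1 inner_scaleR_left 2 q0_def[symmetric] q1_def[symmetric] q2_def[symmetric]
      by (simp add: ex xB) (simp add: algebra_simps power2_eq_square power3_eq_cube power_add)
    also have "(1 - (t * u x)\<^sup>2) * q2 - 2 * (real k + 1) * (t * u x) * q1
            - real k * (real k + 1) * q0 = - (real L * (real L + 1)) * q0"
      using ode by (simp add: algebra_simps)
    also have "h x * u x ^ (k + 2) * (- (real L * (real L + 1)) * q0)
        = - (real L * (real L + 1)) * (q0 * (h x * u x ^ k)) * (u x)\<^sup>2"
      by (simp add: power_add power2_eq_square algebra_simps)
    also have "(u x)\<^sup>2 = 1 / R"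
      using uR R by (simp add: field_simps)
    finally show "poly Q (S x) *
          (h x * (real k * (real k - 1) * u x ^ (k + 2)) + u x ^ k * 0 + 2 * (B x \<bullet> (- (real k * u x ^ (k + 2)) *\<^sub>R x))) +
          h x * u x ^ k *
          (poly (pderiv (pderiv Q)) (S x) * (AS x \<bullet> AS x) +
           poly (pderiv Q) (S x) *
           ((axis 3 1 \<bullet> x) * (real 1 * (real 1 - 1) * u x ^ (1 + 2)) + u x ^ 1 * 0 +
            2 * (axis 3 1 \<bullet> (- (real 1 * u x ^ (1 + 2)) *\<^sub>R x)))) +
          2 * (poly (pderiv Q) (S x) *\<^sub>R AS x \<bullet> AT x)
        = - (real L * (real L + 1)) * harm_product L k z (x /\<^sub>R norm x) / (x \<bullet> x)"
      unfolding fun_cong[OF eq] R_def[symmetric] Sx q0_def[symmetric] by simp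
  qed
qed

definition sph_const :: "nat \<Rightarrow> int \<Rightarrow> real" where
  "sph_const L m = sqrt ((if m = 0 then 1 else 2) * (2 * real L + 1) / (4 * pi)
     * (fact (L - nat \<bar>m\<bar>) / fact (L + nat \<bar>m\<bar>)))"

lemma sph_const_pos: "sph_const L m > 0"
  by (simp add: sph_const_def)

text \<open>For negative orders, the factor \<open>- \<i>\<close> turns the imaginary part into a
  real part.\<close>

lemma sph_harm_eq:
  "sph_harm L m x = sph_const L m * harm_product L (nat \<bar>m\<bar>) (if m \<ge> 0 then 1 else - \<i>) x"
  by (simp add: sph_harm_def Let_def sph_const_def harm_product_def horiz_def)

lemma eigenfunction_sph_harm: "eigenfunction (real L * (real L + 1)) (sph_harm L m)"
  unfolding sph_harm_eq[abs_def] by (rule eigenfunction_cmult[OF eigenfunction_harm_product])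

section \<open>Completeness of the spherical harmonics\<close>

lemma degree_legendre: "degree (legendre L) = L"
proof -
  have "degree ([:- 1, 0, 1::real:] ^ L) = 2 * L"
    by (simp add: degree_power_eq)
  then show ?thesis by (simp add: legendre_def degree_higher_pderiv)
qed

text \<open>Continuity is included because additivity of \<open>sphere_int\<close> depends on
  it.\<close>

definition sphere_orth :: "(real^3 \<Rightarrow> real) \<Rightarrow> (real^3 \<Rightarrow> real) \<Rightarrow> bool" where
  "sphere_orth f g \<longleftrightarrow> continuous_on (sphere 0 1) g \<and> sphere_int (\<lambda>x. f x * g x) = 0"

lemma sphere_orth_add:
  assumes "continuous_on (sphere 0 1) f" "sphere_orth f g" "sphere_orth f h"
  shows "sphere_orth f (\<lambda>x. g x + h x)"
proof -
  have "sphere_int (\<lambda>x. f x * g x + f x * h x) = 0"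
    using assms by (subst sphere_int_add) (auto simp: sphere_orth_def intro!: continuous_on_mult)
  then show ?thesis
    using assms by (auto simp: sphere_orth_def distrib_left intro!: continuous_on_add)
qed

lemma sphere_orth_cmult:
  assumes "sphere_orth f g"
  shows "sphere_orth f (\<lambda>x. c * g x)"
proof -
  have "sphere_int (\<lambda>x. f x * (c * g x)) = sphere_int (\<lambda>x. c * (f x * g x))"
    by (simp add: mult.left_commute)
  then show ?thesis
    using assms by (auto simp: sphere_orth_def sphere_int_cmult intro!: continuous_intros)
qed

lemma sphere_orth_cong:
  assumes "sphere_orth f g" "\<And>x. x \<in> sphere 0 1 \<Longrightarrow> h x = g x"
  shows "sphere_orth f h"
proof -
  have "continuous_on (sphere 0 1) h"
    by (rule continuous_on_eq[of _ g]) (use assms in \<open>simp_all add: sphere_orth_def\<close>)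
  moreover have "sphere_int (\<lambda>x. f x * h x) = sphere_int (\<lambda>x. f x * g x)"
    by (rule sphere_int_cong) (simp only: assms(2))
  ultimately show ?thesis using assms(1) by (simp add: sphere_orth_def)
qed

text \<open>For fixed \<open>k\<close>, the k-th derivative of the Legendre polynomial of degree n +
  k has degree exactly n. These polynomials, n = 0, 1, ..., therefore form a triangular basis of all
  polynomials in \<open>x $ 3\<close>, and orthogonality to the harmonics of order \<open>k\<close>
  extends to any coefficient \<open>q\<close>.\<close>

lemma sphere_orth_polys:
  assumes f: "continuous_on (sphere 0 1) f"
    and orth: "\<And>L m. \<bar>m\<bar> \<le> int L \<Longrightarrow> sphere_int (\<lambda>x. f x * sph_harm L m x) = 0"
  shows "sphere_orth f (\<lambda>x. poly q (x $ 3) * Re (z * horiz x ^ k))"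
proof -
  have hp_sign: "sphere_orth f (harm_product L k (if m \<ge> 0 then 1 else - \<i>))"
    if "nat \<bar>m\<bar> = k" "k \<le> L" for L m
  proof -
    have "sphere_orth f (sph_harm L m)"
      using orth[of m L] that eigenfunction_continuous[OF eigenfunction_sph_harm]
      by (auto simp: sphere_orth_def)
    from sphere_orth_cmult[OF this, of "1 / sph_const L m"] show ?thesis
      by (rule sphere_orth_cong) (use sph_const_pos[of L m] that in \<open>simp add: sph_harm_eq\<close>)
  qed
  have hp_i: "sphere_orth f (harm_product L k (- \<i>))" if "k \<le> L" for L
  \<comment> \<open>There is no sine variant of order 0: the product with factor
    \<open>- \<i>\<close> is identically 0.\<close>
  proof (cases "k = 0")
    case True
    have "sphere_orth f (harm_product L k 1)"
      using hp_sign[of "int k" L] that by simp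
    from sphere_orth_cmult[OF this, of 0] show ?thesis
      by (rule sphere_orth_cong) (simp add: True harm_product_def)
  next
    case False
    then show ?thesis using hp_sign[of "- int k" L] that by simp
  qed
  have hp: "sphere_orth f (harm_product L k z)" if "k \<le> L" for L
  proof -
    have "sphere_orth f (\<lambda>x. Re z * harm_product L k 1 x + (- Im z) * harm_product L k (- \<i>) x)"
      using hp_sign[of "int k" L] hp_i[OF that] that
      by (intro sphere_orth_add sphere_orth_cmult f) auto
    then show ?thesis
      by (rule sphere_orth_cong) (simp add: harm_product_def algebra_simps)
  qed
  have "sphere_orth f (\<lambda>x. poly q (x $ 3) * Re (z * horiz x ^ k))" if "\<And>i. i \<ge> n \<Longrightarrow> coeff q i = 0" for n q
    using that
  proof (induction n arbitrary: q)
    case 0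
    then have "q = 0" by (simp add: poly_eq_iff)
    then show ?case by (simp add: sphere_orth_def sphere_int_def)
  next
    case (Suc n)
    define Q where "Q = (pderiv ^^ k) (legendre (n + k))"
    have degQ: "degree Q = n"
      by (simp add: Q_def degree_higher_pderiv degree_legendre)
    \<comment> \<open>For \<open>n = 0\<close> the degree alone does not exclude the zero
      polynomial, so the constant coefficient is computed there.\<close>
    have "coeff Q n \<noteq> 0"
    proof (cases "n = 0")
      case True
      have "coeff Q 0 = fact k * lead_coeff (legendre k)"
        using True by (simp add: Q_def coeff_higher_pderiv degree_legendre pochhammer_fact[symmetric])
      moreover have "legendre k \<noteq> 0"
      proof (cases "k = 0")
        case True
        then show ?thesis by (simp add: legendre_def)
      next
        case False
        then show ?thesis using degree_legendre[of k] by auto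
      qed
      ultimately show ?thesis using True by simp
    next
      case False
      then show ?thesis using degQ leading_coeff_0_iff[of Q] by auto
    qed
    define c where "c = coeff q n / coeff Q n"
    have "coeff (q - smult c Q) i = 0" if "i \<ge> n" for i
    proof (cases "i = n")
      case True
      then show ?thesis using \<open>coeff Q n \<noteq> 0\<close> by (simp add: c_def)
    next
      case False
      then show ?thesis using Suc.prems[of i] that degQ by (simp add: coeff_eq_0)
    qed
    then have "sphere_orth f (\<lambda>x. poly (q - smult c Q) (x $ 3) * Re (z * horiz x ^ k) + c * harm_product (n + k) k z x)"
      by (intro sphere_orth_add sphere_orth_cmult f hp Suc.IH) auto
    then show ?case
      by (rule sphere_orth_cong) (simp add: harm_product_def Q_def algebra_simps)
  qed
  from this[of "Suc (degree q)" q] show ?thesis by (simp add: coeff_eq_0)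
qed

text \<open>This set is closed under products because \<open>2 Re a Re b = Re (a b) + Re (a cnj b)\<close>; on the sphere
  \<open>|horiz x|\<^sup>2 = 1 - (x $ 3)\<^sup>2\<close> removes mixed powers.\<close>

inductive_set harm_ring :: "(real^3 \<Rightarrow> real) set" where
  gen: "(\<lambda>x. poly q (x $ 3) * Re (z * horiz x ^ j * cnj (horiz x) ^ k)) \<in> harm_ring"
| add: "g \<in> harm_ring \<Longrightarrow> h \<in> harm_ring \<Longrightarrow> (\<lambda>x. g x + h x) \<in> harm_ring"

lemma harm_ring_mult:
  assumes "g \<in> harm_ring" "h \<in> harm_ring"
  shows "(\<lambda>x. g x * h x) \<in> harm_ring"
  using assms
proof (induction rule: harm_ring.induct)
  case (gen q z j k)
  show ?case using gen
  proof (induction rule: harm_ring.induct)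
    case (gen q' z' j' k')
    define a b where "a x = z * horiz x ^ j * cnj (horiz x) ^ k"
      and "b x = z' * horiz x ^ j' * cnj (horiz x) ^ k'" for x
    have "(\<lambda>x. poly (smult (1/2) (q * q')) (x $ 3) * Re (z * z' * horiz x ^ (j + j') * cnj (horiz x) ^ (k + k'))
        + poly (smult (1/2) (q * q')) (x $ 3) * Re (z * cnj z' * horiz x ^ (j + k') * cnj (horiz x) ^ (k + j'))) \<in> harm_ring"
      by (intro harm_ring.intros)
    moreover have "z * z' * horiz x ^ (j + j') * cnj (horiz x) ^ (k + k') = a x * b x"
      "z * cnj z' * horiz x ^ (j + k') * cnj (horiz x) ^ (k + j') = a x * cnj (b x)" for x
      by (simp_all add: a_def b_def power_add mult_ac)
    moreover have "poly q (x $ 3) * Re (a x) * (poly q' (x $ 3) * Re (b x))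
       = poly (smult (1/2) (q * q')) (x $ 3) * Re (a x * b x)
        + poly (smult (1/2) (q * q')) (x $ 3) * Re (a x * cnj (b x))" for x
      by (simp add: field_simps)
    ultimately show ?case by (simp only: a_def[symmetric] b_def[symmetric])
  next
    case (add g h)
    then show ?case using harm_ring.add[OF add.IH] by (simp add: distrib_left)
  qed
next
  case (add g1 g2)
  then show ?case using harm_ring.add[OF add.IH] by (simp add: distrib_right)
qed

lemma continuous_on_harm_ring: "g \<in> harm_ring \<Longrightarrow> continuous_on U g"
  by (induction rule: harm_ring.induct) (intro continuous_intros; assumption)+

text \<open>Prepares Stone-Weierstrass: the three coordinates lie in the ring and separate points,
  the second one as the real part of \<open>- \<i> * horiz x\<close>.\<close>

lemma harm_ring_function_ring: "function_ring_on harm_ring (sphere 0 1)"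
proof
  show "compact (sphere (0::real^3) 1)" by simp
  show "(\<lambda>_. c) \<in> harm_ring" for c
    using harm_ring.gen[of "[:c:]" 1 0 0] by simp
  show "\<exists>g\<in>harm_ring. g x \<noteq> g y" if "x \<noteq> y" for x y
  proof -
    have 1: "(\<lambda>x. x $ 1) \<in> harm_ring"
      using harm_ring.gen[of "[:1:]" 1 1 0] by (simp add: horiz_def)
    have 2: "(\<lambda>x. x $ 2) \<in> harm_ring"
      using harm_ring.gen[of "[:1:]" "- \<i>" 1 0] by (simp add: horiz_def)
    have 3: "(\<lambda>x. x $ 3) \<in> harm_ring"
      using harm_ring.gen[of "[:0,1:]" 1 0 0] by simp
    from that consider "x $ 1 \<noteq> y $ 1" | "x $ 2 \<noteq> y $ 2" | "x $ 3 \<noteq> y $ 3"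
      by (auto simp: vec_eq_iff forall_3)
    then show ?thesis
      by cases (use 1 2 3 in \<open>auto intro: bexI[rotated]\<close>)
  qed
qed (auto intro: continuous_on_harm_ring harm_ring.add harm_ring_mult)

lemma horiz_mult_cnj: "x \<in> sphere 0 1 \<Longrightarrow> horiz x * cnj (horiz x) = of_real (1 - (x $ 3)\<^sup>2)"
proof -
  assume "x \<in> sphere 0 1"
  then have "(x $ 1)\<^sup>2 + (x $ 2)\<^sup>2 + (x $ 3)\<^sup>2 = 1"
    by (simp add: norm_vec_def L2_set_def sum_3)
  then have "(cmod (horiz x))\<^sup>2 = 1 - (x $ 3)\<^sup>2"
    by (simp add: horiz_def cmod_power2)
  then show ?thesis by (simp only: complex_norm_square[symmetric])
qed

lemma sphere_orth_harm_ring: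
  assumes f: "continuous_on (sphere 0 1) f"
    and orth: "\<And>L m. \<bar>m\<bar> \<le> int L \<Longrightarrow> sphere_int (\<lambda>x. f x * sph_harm L m x) = 0"
    and "g \<in> harm_ring"
  shows "sphere_orth f g"
  using assms(3)
proof (induction rule: harm_ring.induct)
  case (gen q z j k)
  have pw: "of_real (1 - (x $ 3)\<^sup>2) ^ n = complex_of_real (poly ([:1, 0, - 1:] ^ n) (x $ 3))" for x :: "real^3" and n
    by (simp add: power2_eq_square)
  have Re_real: "Re (complex_of_real a * b) = a * Re b" for a b by simp
  show ?case
  proof (cases "k \<le> j")
    case True
    show ?thesis
    proof (rule sphere_orth_cong[OF sphere_orth_polys[OF f orth, of "q * [:1, 0, - 1:] ^ k" z "j - k"]])
      fix x :: "real^3" assume x: "x \<in> sphere 0 1"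
      have "z * horiz x ^ j * cnj (horiz x) ^ k = (horiz x * cnj (horiz x)) ^ k * (z * horiz x ^ (j - k))"
        using True by (simp add: power_mult_distrib mult_ac flip: power_add)
      then show "poly q (x $ 3) * Re (z * horiz x ^ j * cnj (horiz x) ^ k)
          = poly (q * [:1, 0, - 1:] ^ k) (x $ 3) * Re (z * horiz x ^ (j - k))"
        unfolding horiz_mult_cnj[OF x] pw by (simp only: Re_real poly_mult mult.assoc)
    qed
  next
    case False
    \<comment> \<open>With more conjugate factors than plain ones, the remaining factor is a
      conjugate; conjugating does not change the real part, which explains
      \<open>cnj z\<close>.\<close>
    show ?thesis
    proof (rule sphere_orth_cong[OF sphere_orth_polys[OF f orth, of "q * [:1, 0, - 1:] ^ j" "cnj z" "k - j"]])
      fix x :: "real^3" assume x: "x \<in> sphere 0 1"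
      have "z * horiz x ^ j * cnj (horiz x) ^ k = (horiz x * cnj (horiz x)) ^ j * cnj (cnj z * horiz x ^ (k - j))"
        using False by (simp add: power_mult_distrib mult_ac flip: power_add)
      then show "poly q (x $ 3) * Re (z * horiz x ^ j * cnj (horiz x) ^ k)
          = poly (q * [:1, 0, - 1:] ^ j) (x $ 3) * Re (cnj z * horiz x ^ (k - j))"
        unfolding horiz_mult_cnj[OF x] pw by (simp only: Re_real poly_mult mult.assoc cnj.simps)
    qed
  qed
next
  case (add g h)
  then show ?case by (intro sphere_orth_add f)
qed

text \<open>If \<open>g\<close> from the ring approximates \<open>f\<close> within \<open>e\<close>,
  then orthogonality gives that the integral of f^2 equals that of f(f - g), hence is at most
  \<open>e\<close> times the integral of |f|. As \<open>e\<close> is arbitrary, f^2 has integral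
  0.\<close>

lemma sph_harm_complete:
  assumes f: "continuous_on (sphere 0 1) f"
    and orth: "\<And>L m. \<bar>m\<bar> \<le> int L \<Longrightarrow> sphere_int (\<lambda>x. f x * sph_harm L m x) = 0"
    and y: "y \<in> sphere 0 1"
  shows "f y = 0"
proof -
  interpret R: function_ring_on harm_ring "sphere 0 1"
    by (rule harm_ring_function_ring)
  have small: "sphere_int (\<lambda>x. f x * f x) \<le> e * sphere_int (\<lambda>x. \<bar>f x\<bar>)" if "e > 0" for e
  proof -
    obtain g where g: "g \<in> harm_ring" "\<And>x. x \<in> sphere 0 1 \<Longrightarrow> \<bar>f x - g x\<bar> < e"
      using R.Stone_Weierstrass_basic[OF f \<open>e > 0\<close>] by blast
    have cg: "continuous_on (sphere 0 1) g" and og: "sphere_int (\<lambda>x. f x * g x) = 0"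
      using sphere_orth_harm_ring[OF f orth g(1)] by (auto simp: sphere_orth_def)
    have "sphere_int (\<lambda>x. f x * f x) = sphere_int (\<lambda>x. f x * f x - f x * g x)"
      using og by (subst sphere_int_diff) (auto intro!: continuous_intros f cg)
    also have "\<dots> \<le> sphere_int (\<lambda>x. e * \<bar>f x\<bar>)"
    proof (rule sphere_int_mono)
      fix x :: "real^3" assume "x \<in> sphere 0 1"
      then have "\<bar>f x\<bar> * \<bar>f x - g x\<bar> \<le> \<bar>f x\<bar> * e"
        using g(2)[of x] by (intro mult_left_mono) auto
      then show "f x * f x - f x * g x \<le> e * \<bar>f x\<bar>"
        by (simp add: abs_mult[symmetric] right_diff_distrib mult.commute[of e])
    qed (intro continuous_intros f cg)+
    finally show ?thesis by (simp add: sphere_int_cmult)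
  qed
  have "sphere_int (\<lambda>x. f x * f x) \<le> 0"
  proof (rule field_le_epsilon)
    fix e :: real assume "e > 0"
    define C where "C = \<bar>sphere_int (\<lambda>x. \<bar>f x\<bar>)\<bar> + 1"
    have "C > 0" by (simp add: C_def add_nonneg_pos)
    have "sphere_int (\<lambda>x. f x * f x) \<le> e / C * sphere_int (\<lambda>x. \<bar>f x\<bar>)"
      using small[of "e / C"] \<open>e > 0\<close> \<open>C > 0\<close> by simp
    also have "\<dots> \<le> e / C * C"
      using \<open>e > 0\<close> \<open>C > 0\<close> by (intro mult_left_mono) (auto simp: C_def)
    finally show "sphere_int (\<lambda>x. f x * f x) \<le> 0 + e"
      using \<open>C > 0\<close> by simp
  qed
  moreover have "sphere_int (\<lambda>x. f x * f x) \<ge> sphere_int (\<lambda>x::real^3. 0)"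
    by (rule sphere_int_mono) (auto intro!: continuous_intros f)
  ultimately have "sphere_int (\<lambda>x. f x * f x) = 0"
    by (simp add: sphere_int_def)
  from sphere_int_eq_0_imp[OF _ _ this y] show ?thesis
    using f by (simp add: continuous_on_mult)
qed

text \<open>The remainder after projection is again an eigenfunction. It is orthogonal to degree
  \<open>L\<close> by construction and to every other degree because L(L + 1) is injective on the
  naturals, so completeness makes it vanish.\<close>

lemma eigenfunction_eq_sph_harm_sum:
  assumes "eigenfunction (real L * (real L + 1)) f"
  shows "\<exists>c. \<forall>x\<in>sphere 0 1. f x = (\<Sum>m = - int L..int L. c m * sph_harm L m x)"
proof -
  have cf: "continuous_on (sphere 0 1) f"
    by (rule eigenfunction_continuous[OF assms])
  obtain c where c: "\<forall>j\<in>{- int L..int L}.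
      sphere_int (\<lambda>x. (f x - (\<Sum>m = - int L..int L. c m * sph_harm L m x)) * sph_harm L j x) = 0"
    using projection_exists[of "{- int L..int L}" f "sph_harm L"] cf
      eigenfunction_continuous[OF eigenfunction_sph_harm] by auto
  define g where "g x = f x - (\<Sum>m = - int L..int L. c m * sph_harm L m x)" for x
  have g: "eigenfunction (real L * (real L + 1)) g"
    unfolding g_def by (rule eigenfunction_diff_sum) (auto intro: assms eigenfunction_sph_harm)
  have "g x = 0" if "x \<in> sphere 0 1" for x
  proof (rule sph_harm_complete[OF eigenfunction_continuous[OF g] _ that])
    fix M m assume m: "\<bar>m\<bar> \<le> int M"
    show "sphere_int (\<lambda>x. g x * sph_harm M m x) = 0"
    proof (cases "M = L")
      case True
      then show ?thesis using c[rule_format, of m] m by (simp add: g_def abs_le_iff)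
    next
      case False
      have "real L * (real L + 1) \<noteq> real M * (real M + 1)"
      proof
        assume "real L * (real L + 1) = real M * (real M + 1)"
        then have "(real L - real M) * (real L + real M + 1) = 0" by (simp add: algebra_simps)
        then show False using False by simp
      qed
      then show ?thesis by (rule eigenfunctions_orthogonal[OF g eigenfunction_sph_harm])
    qed
  qed
  then show ?thesis by (intro exI[of _ c]) (simp add: g_def)
qed

lemma eigenfunction_eq_0:
  fixes f :: "real^3 \<Rightarrow> real"
  assumes "eigenfunction \<mu> f" "\<And>L::nat. \<mu> \<noteq> real L * (real L + 1)" "x \<in> sphere 0 1"
  shows "f x = 0"
  by (rule sph_harm_complete[OF eigenfunction_continuous[OF assms(1)] _ assms(3)])
     (rule eigenfunctions_orthogonal[OF assms(1) eigenfunction_sph_harm assms(2)])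

section \<open>Irrotational homogeneous flows\<close>

text \<open>Continuity of the derivative is asked direction by direction, which in finite dimension
  is ordinary C^1; this is the form in which \<open>bump_divergence_integral\<close> takes
  it.\<close>

definition C1_off_0 :: "('a::euclidean_space \<Rightarrow> 'b::real_normed_vector) \<Rightarrow> bool" where
  "C1_off_0 g \<longleftrightarrow> (\<exists>g'. (\<forall>x. x \<noteq> 0 \<longrightarrow> (g has_derivative g' x) (at x)) \<and>
     (\<forall>e. continuous_on (- {0}) (\<lambda>x. g' x e)))"

lemma C1_off_0I:
  assumes "\<And>x. x \<noteq> 0 \<Longrightarrow> (g has_derivative g' x) (at x)"
    and "\<And>e. continuous_on (- {0}) (\<lambda>x. g' x e)"
  shows "C1_off_0 g"
  using assms unfolding C1_off_0_def by (intro exI[of _ g'] conjI allI impI)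

lemma C1_off_0E:
  assumes "C1_off_0 g"
  obtains g' where "\<And>x. x \<noteq> 0 \<Longrightarrow> (g has_derivative g' x) (at x)"
    and "\<And>e. continuous_on (- {0}) (\<lambda>x. g' x e)" and "continuous_on (- {0}) g"
proof -
  obtain g' where g': "\<forall>x. x \<noteq> 0 \<longrightarrow> (g has_derivative g' x) (at x)"
    "\<forall>e. continuous_on (- {0}) (\<lambda>x. g' x e)"
    using assms unfolding C1_off_0_def by (elim exE conjE)
  have "isCont g x" if "x \<noteq> 0" for x
    using has_derivative_continuous[of g _ x UNIV] g'(1) that by auto
  then have "continuous_on (- {0}) g"
    by (auto intro!: continuous_at_imp_continuous_on)
  with g' show thesis by (intro that[of g']) auto
qed

lemma C1_off_0_add:
  assumes "C1_off_0 g" "C1_off_0 h"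
  shows "C1_off_0 (\<lambda>x. g x + h x)"
proof -
  obtain g' where g: "\<And>x. x \<noteq> 0 \<Longrightarrow> (g has_derivative g' x) (at x)"
    "\<And>e. continuous_on (- {0}) (\<lambda>x. g' x e)" "continuous_on (- {0}) g"
    using assms(1) by (rule C1_off_0E) (rule that; assumption)
  obtain h' where h: "\<And>x. x \<noteq> 0 \<Longrightarrow> (h has_derivative h' x) (at x)"
    "\<And>e. continuous_on (- {0}) (\<lambda>x. h' x e)" "continuous_on (- {0}) h"
    using assms(2) by (rule C1_off_0E) (rule that; assumption)
  show ?thesis
    by (rule C1_off_0I[where g' = "\<lambda>x e. g' x e + h' x e"])
       (intro has_derivative_add continuous_on_add g h; assumption)+
qed

lemma C1_off_0_scaleR:
  fixes c :: "'a::euclidean_space \<Rightarrow> real"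
  assumes "C1_off_0 c" "C1_off_0 g"
  shows "C1_off_0 (\<lambda>x. c x *\<^sub>R g x)"
proof -
  obtain c' where c: "\<And>x. x \<noteq> 0 \<Longrightarrow> (c has_derivative c' x) (at x)"
    "\<And>e. continuous_on (- {0}) (\<lambda>x. c' x e)" "continuous_on (- {0}) c"
    using assms(1) by (rule C1_off_0E) (rule that; assumption)
  obtain g' where g: "\<And>x. x \<noteq> 0 \<Longrightarrow> (g has_derivative g' x) (at x)"
    "\<And>e. continuous_on (- {0}) (\<lambda>x. g' x e)" "continuous_on (- {0}) g"
    using assms(2) by (rule C1_off_0E) (rule that; assumption)
  show ?thesis
    by (rule C1_off_0I[where g' = "\<lambda>x e. c x *\<^sub>R g' x e + c' x e *\<^sub>R g x"])
       (intro has_derivative_scaleR continuous_intros c g; assumption)+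
qed

lemma has_derivative_norm_powr:
  fixes x :: "'a::real_inner"
  assumes "x \<noteq> 0"
  shows "((\<lambda>x. norm x powr b) has_derivative (\<lambda>h. b * norm x powr (b - 2) * (x \<bullet> h))) (at x)"
proof -
  have "((\<lambda>x. norm x powr b) has_derivative
      (\<lambda>h. b * norm x powr (b - 1) * (h \<bullet> sgn x))) (at x)"
    using has_derivative_compose[OF has_derivative_norm[OF assms]
        has_real_derivative_powr[of "norm x" b, unfolded has_field_derivative_def]] assms
    by simp
  moreover have "norm x powr (b - 1) / norm x = norm x powr (b - 2)"
    using assms powr_diff[of "norm x" "b - 1" 1] by simp
  ultimately show ?thesis
    by (elim has_derivative_eq_rhs)
       (auto simp: fun_eq_iff sgn_div_norm inner_commute divide_inverse mult.assoc)
qed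

lemma C1_off_0_norm_powr: "C1_off_0 (\<lambda>x. norm x powr b)"
  by (rule C1_off_0I[OF has_derivative_norm_powr]) (auto intro!: continuous_intros)

lemma has_derivative_normalize:
  fixes x :: "'a::real_inner"
  assumes "x \<noteq> 0"
  shows "((\<lambda>x. x /\<^sub>R norm x) has_derivative
     (\<lambda>h. inverse (norm x) *\<^sub>R h + (- (inverse (norm x) ^ 3 * (x \<bullet> h))) *\<^sub>R x)) (at x)"
proof -
  have "((\<lambda>x. inverse (norm x) ^ 1) has_derivative
     (\<lambda>h. - (real 1 * inverse (norm x) ^ (1 + 2) * (x \<bullet> h)))) (at x)"
    by (rule has_derivative_inverse_norm_power[OF assms])
  from has_derivative_scaleR[OF this has_derivative_ident] show ?thesis
    by (simp add: numeral_3_eq_3)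
qed

text \<open>A C^1 function on the sphere comes with an extension to a neighbourhood; composed with
  normalisation, the extension is evaluated only on the sphere, where it agrees with
  \<open>g\<close>.\<close>

lemma C1_off_0_normalize:
  assumes "C1_on_S2 g"
  shows "C1_off_0 (\<lambda>x. g (x /\<^sub>R norm x))"
proof -
  obtain U h where U: "open U" "S2 \<subseteq> U" "C1_on U h" "\<forall>x\<in>S2. h x = g x"
    using assms unfolding C1_on_S2_def by (elim exE conjE)
  obtain h' where h': "\<forall>x\<in>U. (h has_derivative blinfun_apply (h' x)) (at x)" "continuous_on U h'"
    using U(3) unfolding C1_on_def by (elim exE conjE)
  have nU: "x /\<^sub>R norm x \<in> U" if "x \<noteq> 0" for x :: "real^3"
    using normalize_in_sphere[OF that] U(2) by (rule subsetD[rotated])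
  show ?thesis
  proof (rule C1_off_0I[where g' = "\<lambda>x e. blinfun_apply (h' (x /\<^sub>R norm x))
      (inverse (norm x) *\<^sub>R e + (- (inverse (norm x) ^ 3 * (x \<bullet> e))) *\<^sub>R x)"])
    fix x :: "real^3" assume x: "x \<noteq> 0"
    have "((\<lambda>x. h (x /\<^sub>R norm x)) has_derivative (\<lambda>e. blinfun_apply (h' (x /\<^sub>R norm x))
      (inverse (norm x) *\<^sub>R e + (- (inverse (norm x) ^ 3 * (x \<bullet> e))) *\<^sub>R x))) (at x)"
      by (rule has_derivative_compose[OF has_derivative_normalize[OF x]]) (use h' nU x in simp)
    then show "((\<lambda>x. g (x /\<^sub>R norm x)) has_derivative (\<lambda>e. blinfun_apply (h' (x /\<^sub>R norm x))
      (inverse (norm x) *\<^sub>R e + (- (inverse (norm x) ^ 3 * (x \<bullet> e))) *\<^sub>R x))) (at x)"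
      by (rule has_derivative_transform_within_open[where s = "- {0}"])
         (use x U(4) normalize_in_sphere in \<open>auto simp: open_Compl\<close>)
  next
    fix e :: "real^3"
    have "continuous_on (- {0}) (\<lambda>x. h' (x /\<^sub>R norm x))"
      by (rule continuous_on_compose2[OF h'(2)]) (auto intro!: continuous_intros nU)
    then show "continuous_on (- {0}) (\<lambda>x. blinfun_apply (h' (x /\<^sub>R norm x))
      (inverse (norm x) *\<^sub>R e + (- (inverse (norm x) ^ 3 * (x \<bullet> e))) *\<^sub>R x))"
      by (intro bounded_bilinear.continuous_on[OF bounded_bilinear_blinfun_apply] continuous_intros) auto
  qed
qed

lemma velocity_alt:
  "velocity \<alpha> v f = (\<lambda>x. (norm x powr - \<alpha>) *\<^sub>R (v (x /\<^sub>R norm x) + f (x /\<^sub>R norm x) *\<^sub>R (x /\<^sub>R norm x)))"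
  by (simp add: fun_eq_iff velocity_def Let_def powr_minus)

lemma C1_off_0_velocity:
  assumes "C1_on_S2 v" "C1_on_S2 f"
  shows "C1_off_0 (velocity \<alpha> v f)"
proof -
  have "C1_on UNIV (\<lambda>x::real^3. x)"
    unfolding C1_on_def by (rule exI[of _ "\<lambda>x. id_blinfun"]) (auto simp: id_def intro!: derivative_eq_intros)
  then have "C1_on_S2 (\<lambda>x. x)"
    unfolding C1_on_S2_def by (intro exI[of _ UNIV] exI[of _ "\<lambda>x. x"]) auto
  note n = C1_off_0_normalize[OF this]
  show ?thesis
    unfolding velocity_alt
    by (rule C1_off_0_scaleR[OF C1_off_0_norm_powr C1_off_0_add[OF C1_off_0_normalize[OF assms(1)]
          C1_off_0_scaleR[OF C1_off_0_normalize[OF assms(2)] n]]])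
qed

lemma pressure_alt:
  "pressure \<alpha> p = (\<lambda>x. (norm x powr - (2 * \<alpha>)) *\<^sub>R p (x /\<^sub>R norm x))"
  unfolding pressure_def powr_minus by (simp add: fun_eq_iff divide_inverse)

lemma C1_off_0_pressure:
  assumes "C1_on_S2 p"
  shows "C1_off_0 (pressure \<alpha> p)"
  unfolding pressure_alt by (intro C1_off_0_scaleR C1_off_0_normalize C1_off_0_norm_powr assms)

lemma partial_eq:
  assumes "(g has_derivative g') (at x)"
  shows "partial i g x = g' (axis i 1)"
  unfolding partial_def using frechet_derivative_at[OF assms] by simp

lemma vec3_expansion: "a = (a $ 1) *\<^sub>R axis 1 1 + (a $ 2) *\<^sub>R axis 2 1 + (a $ 3) *\<^sub>R axis 3 (1::real)"
  for a :: "real^3"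
  by (simp add: vec_eq_iff forall_3 axis_def)

lemma linear_vec3:
  fixes T :: "real^3 \<Rightarrow> 'b::real_vector"
  assumes "linear T"
  shows "T a = (a $ 1) *\<^sub>R T (axis 1 1) + (a $ 2) *\<^sub>R T (axis 2 1) + (a $ 3) *\<^sub>R T (axis 3 1)"
proof -
  have "T a = T ((a $ 1) *\<^sub>R axis 1 1 + (a $ 2) *\<^sub>R axis 2 1 + (a $ 3) *\<^sub>R axis 3 (1::real))"
    by (rule arg_cong[OF vec3_expansion])
  then show ?thesis by (simp add: linear_add[OF assms] linear_scale[OF assms])
qed

text \<open>The components of the curl are the differences of opposite off-diagonal entries of the
  Jacobian matrix.\<close>

lemma linear_symmetric_of_curl:
  fixes T :: "real^3 \<Rightarrow> real^3"
  assumes "linear T" "T (axis 2 1) $ 3 = T (axis 3 1) $ 2" "T (axis 3 1) $ 1 = T (axis 1 1) $ 3"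
    "T (axis 1 1) $ 2 = T (axis 2 1) $ 1"
  shows "T a \<bullet> b = a \<bullet> T b"
  unfolding linear_vec3[OF assms(1), of a] linear_vec3[OF assms(1), of b] inner_vec_def sum_3
  using assms(2-) by (simp add: algebra_simps)

text \<open>Vanishing curl and divergence in linear-algebra form: a symmetric, trace-free
  derivative. The momentum equation enters later, as a premise of
  \<open>bernoulli_const\<close>.\<close>

locale irrotational_flow =
  fixes \<alpha> :: real and v :: "real^3 \<Rightarrow> real^3" and f :: "real^3 \<Rightarrow> real"
    and V' :: "real^3 \<Rightarrow> real^3 \<Rightarrow> real^3"
  assumes tangent: "x \<in> S2 \<Longrightarrow> v x \<bullet> x = 0"
    and deriv: "x \<noteq> 0 \<Longrightarrow> (velocity \<alpha> v f has_derivative V' x) (at x)"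
    and deriv_cont: "continuous_on (- {0}) (\<lambda>x. V' x e)"
    and deriv_sym: "x \<noteq> 0 \<Longrightarrow> V' x a \<bullet> b = a \<bullet> V' x b"
    and deriv_trace: "x \<noteq> 0 \<Longrightarrow> (\<Sum>i\<in>Basis. V' x i \<bullet> i) = 0"
begin

abbreviation V :: "real^3 \<Rightarrow> real^3" where
  "V \<equiv> velocity \<alpha> v f"

lemma velocity_radial:
  assumes "x \<noteq> 0"
  shows "V x \<bullet> x = norm x powr (1 - \<alpha>) * f (x /\<^sub>R norm x)"
proof -
  have "v (x /\<^sub>R norm x) \<bullet> x = norm x * (v (x /\<^sub>R norm x) \<bullet> (x /\<^sub>R norm x))"
    using assms by simp
  also have "\<dots> = 0" using tangent[OF normalize_in_sphere[OF assms]] by (simp only: mult_zero_right)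
  finally have "V x \<bullet> x = norm x powr - \<alpha> * (f (x /\<^sub>R norm x) * norm x)"
    using assms by (simp add: velocity_alt inner_add_left dot_square_norm power2_eq_square)
  moreover have "norm x powr (1 - \<alpha>) = norm x * norm x powr - \<alpha>"
    using assms powr_add[of "norm x" 1 "- \<alpha>"] by simp
  ultimately show ?thesis by simp
qed

lemma velocity_homogeneous:
  assumes "t > 0"
  shows "V (t *\<^sub>R x) = (t powr - \<alpha>) *\<^sub>R V x"
proof -
  have n: "(t *\<^sub>R x) /\<^sub>R norm (t *\<^sub>R x) = x /\<^sub>R norm x"
    using assms by (simp add: field_simps)
  show ?thesis
    unfolding velocity_alt n using assms by (simp add: powr_mult)
qed

lemma deriv_linear: "x \<noteq> 0 \<Longrightarrow> linear (V' x)"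
  using has_derivative_linear[OF deriv] .

text \<open>Euler's relation for a field homogeneous of degree - \<alpha>, obtained by
  differentiating along the ray at \<open>t = 1\<close>.\<close>

lemma deriv_radial:
  assumes "x \<noteq> 0"
  shows "V' x x = - \<alpha> *\<^sub>R V x"
proof -
  have 1: "((\<lambda>t. t *\<^sub>R x) has_derivative (\<lambda>t. t *\<^sub>R x)) (at (1::real))"
    by (auto intro!: derivative_eq_intros)
  have "(V has_derivative V' x) (at (1 *\<^sub>R x))"
    using deriv[OF assms] by simp
  from has_derivative_compose[OF 1 this]
  have "((\<lambda>t. V (t *\<^sub>R x)) has_derivative (\<lambda>t. V' x (t *\<^sub>R x))) (at (1::real))" .
  then have "((\<lambda>t. (t powr - \<alpha>) *\<^sub>R V x) has_derivative (\<lambda>t. V' x (t *\<^sub>R x))) (at (1::real))"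
    by (rule has_derivative_transform_within_open[where s = "{0<..}"]) (auto simp: velocity_homogeneous)
  moreover have "((\<lambda>t. (t powr - \<alpha>) *\<^sub>R V x) has_derivative (\<lambda>t. (t * - \<alpha>) *\<^sub>R V x)) (at (1::real))"
    by (rule has_derivative_scaleR_left,
        rule has_derivative_eq_rhs[OF has_real_derivative_powr[of 1 "- \<alpha>", unfolded has_field_derivative_def]])
       (auto simp: fun_eq_iff)
  ultimately have "(\<lambda>t::real. V' x (t *\<^sub>R x)) = (\<lambda>t. (t * - \<alpha>) *\<^sub>R V x)"
    by (rule has_derivative_unique)
  from fun_cong[OF this, of 1] show ?thesis by simp
qed

lemma tangential_part_eq:
  assumes "x \<noteq> 0"
  shows "(norm x powr (\<alpha> - 1)) *\<^sub>R V x - (f (x /\<^sub>R norm x) * norm x powr - 2) *\<^sub>R x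
    = v (x /\<^sub>R norm x) /\<^sub>R norm x"
proof -
  have 1: "norm x powr (\<alpha> - 1) * norm x powr - \<alpha> = inverse (norm x)"
    using assms powr_add[of "norm x" "\<alpha> - 1" "- \<alpha>"] by (simp add: powr_minus)
  have 2: "norm x powr - 2 = inverse (norm x) * inverse (norm x)"
    using assms by (simp add: powr_minus power2_eq_square powr_realpow[of _ 2, simplified])
  show ?thesis
    unfolding velocity_alt scaleR_scaleR 1 2 by (simp add: scaleR_add_right mult.commute)
qed

text \<open>Up to the factor 1 - \<alpha> this is the tangential part of \<open>V\<close>, rescaled
  to degree -1. It is written with \<open>V\<close> and \<open>f\<close> because their derivatives
  are already at hand, so differentiating it gives the second derivative of
  \<open>f\<close>.\<close>

definition grad_f :: "real^3 \<Rightarrow> real^3" where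
  "grad_f x = (1 - \<alpha>) *\<^sub>R ((norm x powr (\<alpha> - 1)) *\<^sub>R V x - (f (x /\<^sub>R norm x) * norm x powr - 2) *\<^sub>R x)"

lemma grad_f_eq: "x \<noteq> 0 \<Longrightarrow> grad_f x = (1 - \<alpha>) *\<^sub>R (v (x /\<^sub>R norm x) /\<^sub>R norm x)"
  unfolding grad_f_def by (rule arg_cong[OF tangential_part_eq])

text \<open>The extension of \<open>f\<close> is |x|^(\<alpha> - 1) times
  \<open>V x \<bullet> x\<close>. Symmetry and Euler's relation give
  \<open>V' x h \<bullet> x = - \<alpha> * (V x \<bullet> h)\<close>, so differentiating
  \<open>V x \<bullet> x\<close> yields 1 - \<alpha> times \<open>V x \<bullet> h\<close>.\<close>

lemma f_deriv:
  assumes x: "x \<noteq> 0"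
  shows "((\<lambda>y. f (y /\<^sub>R norm y)) has_derivative (\<lambda>h. grad_f x \<bullet> h)) (at x)"
proof -
  have "((\<lambda>y. norm y powr (\<alpha> - 1) * (V y \<bullet> y)) has_derivative
      (\<lambda>h. norm x powr (\<alpha> - 1) * (V x \<bullet> h + V' x h \<bullet> x)
         + ((\<alpha> - 1) * norm x powr (\<alpha> - 1 - 2) * (x \<bullet> h)) * (V x \<bullet> x))) (at x)"
    by (intro has_derivative_mult has_derivative_norm_powr has_derivative_inner deriv x has_derivative_ident)
  then have "((\<lambda>y. f (y /\<^sub>R norm y)) has_derivative
      (\<lambda>h. norm x powr (\<alpha> - 1) * (V x \<bullet> h + V' x h \<bullet> x)
         + ((\<alpha> - 1) * norm x powr (\<alpha> - 1 - 2) * (x \<bullet> h)) * (V x \<bullet> x))) (at x)"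
    by (rule has_derivative_transform_within_open[where s = "- {0}"])
       (use x in \<open>auto simp: velocity_radial open_Compl mult.assoc[symmetric] powr_add[symmetric]\<close>)
  moreover have "norm x powr (\<alpha> - 1) * (V x \<bullet> h + V' x h \<bullet> x)
         + ((\<alpha> - 1) * norm x powr (\<alpha> - 1 - 2) * (x \<bullet> h)) * (V x \<bullet> x) = grad_f x \<bullet> h" for h
  proof -
    have "V' x h \<bullet> x = - \<alpha> * (V x \<bullet> h)"
      using deriv_sym[OF x, of h x] by (simp add: deriv_radial[OF x] inner_commute)
    moreover have "norm x powr (\<alpha> - 1 - 2) * (V x \<bullet> x) = f (x /\<^sub>R norm x) * norm x powr - 2"
      using x powr_add[of "norm x" "\<alpha> - 1 - 2" "1 - \<alpha>"] by (simp add: velocity_radial)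
    ultimately show ?thesis
      unfolding grad_f_def by (simp add: inner_diff_left algebra_simps)
  qed
  ultimately show ?thesis by simp
qed

lemma surface_grad_eq:
  assumes "x \<in> S2"
  shows "surface_grad f x = (1 - \<alpha>) *\<^sub>R v x"
proof -
  have x: "x \<noteq> 0" using assms by auto
  have "surface_grad f x = grad_f x"
    unfolding surface_grad_def grad_def partial_eq[OF f_deriv[OF x]]
    by (simp add: vec_eq_iff inner_axis)
  then show ?thesis using grad_f_eq[OF x] assms by simp
qed

lemma grad_f_tangent:
  assumes "x \<noteq> 0"
  shows "grad_f x \<bullet> x = 0"
  by (rule radial_derivative_eq_0[OF f_deriv[OF assms] assms])

definition grad_f_deriv :: "real^3 \<Rightarrow> real^3 \<Rightarrow> real^3" where
  "grad_f_deriv x h = (1 - \<alpha>) *\<^sub>R (((norm x powr (\<alpha> - 1)) *\<^sub>R V' x h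
      + ((\<alpha> - 1) * norm x powr (\<alpha> - 1 - 2) * (x \<bullet> h)) *\<^sub>R V x)
     - ((f (x /\<^sub>R norm x) * norm x powr - 2) *\<^sub>R h
      + (f (x /\<^sub>R norm x) * (- 2 * norm x powr (- 2 - 2) * (x \<bullet> h)) + (grad_f x \<bullet> h) * norm x powr - 2) *\<^sub>R x))"

lemma V_cont: "continuous_on (- {0}) V"
  by (rule continuous_at_imp_continuous_on) (auto intro: has_derivative_continuous[OF deriv])

lemma f_cont: "continuous_on (- {0}) (\<lambda>x. f (x /\<^sub>R norm x))"
  by (rule continuous_at_imp_continuous_on) (auto intro: has_derivative_continuous[OF f_deriv])

lemma grad_f_cont: "continuous_on (- {0}) grad_f"
  unfolding grad_f_def[abs_def] by (intro continuous_intros V_cont f_cont) auto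

text \<open>In the divergence of \<open>grad_f\<close>, the trace of \<open>V'\<close> and the
  product of \<open>grad_f\<close> with \<open>x\<close> vanish. In units of f/|x|^2 the other terms
  are \<alpha> - 1 from the power before \<open>V\<close>, -3 from the divergence of
  \<open>x\<close> and +2 from the power before \<open>x\<close>; they add up to \<alpha> -
  2.\<close>

lemma eigenfunction_f: "eigenfunction ((1 - \<alpha>) * (2 - \<alpha>)) f"
proof -
  have "(grad_f has_derivative grad_f_deriv x) (at x)" if x: "x \<noteq> 0" for x
    unfolding grad_f_def[abs_def] grad_f_deriv_def[abs_def]
    by (intro has_derivative_scaleR_right has_derivative_diff has_derivative_scaleR has_derivative_mult
        has_derivative_norm_powr f_deriv[unfolded grad_f_def] deriv x has_derivative_ident)
  moreover have "continuous_on (- {0}) (\<lambda>x. grad_f_deriv x e)" for e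
    unfolding grad_f_deriv_def by (intro continuous_intros V_cont f_cont grad_f_cont deriv_cont) auto
  moreover have "(\<Sum>i\<in>Basis. grad_f_deriv x i \<bullet> i) = - ((1 - \<alpha>) * (2 - \<alpha>)) * f (x /\<^sub>R norm x) / (x \<bullet> x)"
    if x: "x \<noteq> 0" for x
  proof -
    have ip: "(\<Sum>i\<in>Basis. (a \<bullet> i) * (b \<bullet> i)) = a \<bullet> b" for a b :: "real^3"
      by (simp add: euclidean_inner[symmetric])
    have ii: "(\<Sum>i\<in>Basis. i \<bullet> (i::real^3)) = 3"
      unfolding sum_Basis_vec3 by (simp add: inner_axis_axis)
    have p2: "norm x powr - 2 = 1 / (x \<bullet> x)"
      using x by (simp add: powr_minus dot_square_norm divide_inverse powr_realpow[of _ 2, simplified])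
    have p4: "norm x powr (- 2 - 2) * (x \<bullet> x) = norm x powr - 2"
      using x powr_add[of "norm x" "- 2 - 2" 2] by (simp add: dot_square_norm powr_realpow[of _ 2, simplified])
    have pV: "norm x powr (\<alpha> - 1 - 2) * (x \<bullet> V x) = f (x /\<^sub>R norm x) * norm x powr - 2"
      using x powr_add[of "norm x" "\<alpha> - 1 - 2" "1 - \<alpha>"] by (simp add: velocity_radial inner_commute[of x])
    have "(\<Sum>i\<in>Basis. grad_f_deriv x i \<bullet> i) = (1 - \<alpha>) * (norm x powr (\<alpha> - 1) * (\<Sum>i\<in>Basis. V' x i \<bullet> i)
      + (\<alpha> - 1) * norm x powr (\<alpha> - 1 - 2) * (\<Sum>i\<in>Basis. (x \<bullet> i) * (V x \<bullet> i))
      - f (x /\<^sub>R norm x) * norm x powr - 2 * (\<Sum>i\<in>Basis. i \<bullet> (i::real^3))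
      + 2 * f (x /\<^sub>R norm x) * norm x powr (- 2 - 2) * (\<Sum>i\<in>Basis. (x \<bullet> i) * (x \<bullet> i))
      - norm x powr - 2 * (\<Sum>i\<in>Basis. (grad_f x \<bullet> i) * (x \<bullet> i)))"
      unfolding grad_f_deriv_def sum_distrib_left sum.distrib[symmetric] sum_subtractf[symmetric]
      by (rule sum.cong) (simp_all only: inner_scaleR_left inner_add_left inner_diff_left, simp add: algebra_simps)
    also have "\<dots> = (1 - \<alpha>) * ((\<alpha> - 1) * (norm x powr (\<alpha> - 1 - 2) * (x \<bullet> V x))
      - 3 * f (x /\<^sub>R norm x) * norm x powr - 2
      + 2 * f (x /\<^sub>R norm x) * (norm x powr (- 2 - 2) * (x \<bullet> x)))"
      unfolding ip ii deriv_trace[OF x] grad_f_tangent[OF x] by (simp add: algebra_simps)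
    also have "\<dots> = - ((1 - \<alpha>) * (2 - \<alpha>)) * (f (x /\<^sub>R norm x) * norm x powr - 2)"
      unfolding p4 pV by (simp add: algebra_simps)
    finally show ?thesis unfolding p2 by simp
  qed
  ultimately have "eigen_data ((1 - \<alpha>) * (2 - \<alpha>)) f grad_f grad_f_deriv"
    unfolding eigen_data_def using f_deriv by auto
  then show ?thesis unfolding eigenfunction_def by blast
qed

end

section \<open>The case of degree minus one\<close>

text \<open>Three-space without a point is connected.\<close>

lemma constant_of_zero_derivative_off_0:
  fixes g :: "real^3 \<Rightarrow> real"
  assumes "\<And>x. x \<noteq> 0 \<Longrightarrow> (g has_derivative (\<lambda>h. 0)) (at x)"
  shows "\<exists>c. \<forall>x. x \<noteq> 0 \<longrightarrow> g x = c"
proof -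
  have "g constant_on (- {0})"
  proof (rule has_derivative_zero_connected_constant_on[where K = "{}"])
    show "connected (- {0::real^3})"
      by (rule connected_punctured_universe) simp
    show "continuous_on (- {0}) g"
      by (rule continuous_at_imp_continuous_on) (auto intro: has_derivative_continuous[OF assms])
  qed (auto intro: has_derivative_at_withinI assms)
  then show ?thesis
    unfolding constant_on_def by auto
qed

context irrotational_flow
begin

lemma radial_part_eq_0:
  assumes "\<alpha> = 1" "x \<in> S2"
  shows "f x = 0"
proof -
  have "((\<lambda>y. f (y /\<^sub>R norm y)) has_derivative (\<lambda>h. 0)) (at x)" if "x \<noteq> 0" for x
  proof -
    have "grad_f x = 0" unfolding grad_f_def using assms(1) by simp
    then show ?thesis using f_deriv[OF that] by simp
  qed
  then obtain c where c: "\<And>x. x \<noteq> 0 \<Longrightarrow> f (x /\<^sub>R norm x) = c"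
    using constant_of_zero_derivative_off_0[of "\<lambda>x. f (x /\<^sub>R norm x)"] by auto
  \<comment> \<open>Removing the radial part c x/|x|^2 makes the field tangential, as
    \<open>bump_divergence_integral\<close> requires. Since \<open>V\<close> is divergence-free,
    what remains has divergence - c/|x|^2, whose shell integral can vanish only for
    \<open>c = 0\<close>.\<close>
  define B where "B x = V x - (c * norm x powr - 2) *\<^sub>R x" for x
  define B' where "B' x h = V' x h - ((c * norm x powr - 2) *\<^sub>R h
      + (c * (- 2 * norm x powr (- 2 - 2) * (x \<bullet> h))) *\<^sub>R x)" for x h
  have B_deriv: "(B has_derivative B' x) (at x)" if "x \<noteq> 0" for x
    unfolding B_def[abs_def] B'_def[abs_def]
    by (intro has_derivative_diff has_derivative_scaleR has_derivative_mult_right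
        has_derivative_norm_powr deriv that has_derivative_ident)
  have B'_cont: "continuous_on (- {0}) (\<lambda>x. B' x e)" for e
    unfolding B'_def by (intro continuous_intros deriv_cont) auto
  have p2: "norm x powr - 2 = 1 / (x \<bullet> x)" if "x \<noteq> 0" for x :: "real^3"
    using that by (simp add: powr_minus dot_square_norm divide_inverse powr_realpow[of _ 2, simplified])
  have B_tangent: "B x \<bullet> x = 0" if "x \<noteq> 0" for x
    using that velocity_radial[OF that] assms(1) by (simp add: B_def inner_diff_left p2 c)
  have B_trace: "(\<Sum>i\<in>Basis. B' x i \<bullet> i) = - c / (x \<bullet> x)" if x: "x \<noteq> 0" for x
  proof -
    have ii: "(\<Sum>i\<in>Basis. i \<bullet> (i::real^3)) = 3"
      unfolding sum_Basis_vec3 by (simp add: inner_axis_axis)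
    have p4: "norm x powr (- 2 - 2) * (x \<bullet> x) = norm x powr - 2"
      using x powr_add[of "norm x" "- 2 - 2" 2] by (simp add: dot_square_norm powr_realpow[of _ 2, simplified])
    have "(\<Sum>i\<in>Basis. B' x i \<bullet> i) = (\<Sum>i\<in>Basis. V' x i \<bullet> i)
      - c * norm x powr - 2 * (\<Sum>i\<in>Basis. i \<bullet> (i::real^3))
      + 2 * c * norm x powr (- 2 - 2) * (\<Sum>i\<in>Basis. (x \<bullet> i) * (x \<bullet> i))"
      unfolding B'_def sum_distrib_left sum.distrib[symmetric] sum_subtractf[symmetric]
      by (rule sum.cong[OF refl], simp only: inner_scaleR_left inner_add_left inner_diff_left)
    also have "\<dots> = - 3 * c * norm x powr - 2 + 2 * c * (norm x powr (- 2 - 2) * (x \<bullet> x))"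
      unfolding ii deriv_trace[OF x] euclidean_inner[symmetric] by simp
    finally show ?thesis unfolding p4 by (simp add: p2[OF x])
  qed
  have "(\<integral>x. bump (x \<bullet> x) * (1 * (\<Sum>i\<in>Basis. B' x i \<bullet> i) + B x \<bullet> 0) \<partial>lborel) = 0"
    by (rule bump_divergence_integral(2)) (use B_deriv B'_cont B_tangent in \<open>auto\<close>)
  also have "(\<integral>x. bump (x \<bullet> x) * (1 * (\<Sum>i\<in>Basis. B' x i \<bullet> i) + B x \<bullet> 0) \<partial>lborel)
      = sphere_int (\<lambda>x::real^3. (- c) * 1)"
    unfolding sphere_int_def
  proof (rule Bochner_Integration.integral_cong)
    fix x :: "real^3"
    show "bump (x \<bullet> x) * (1 * (\<Sum>i\<in>Basis. B' x i \<bullet> i) + B x \<bullet> 0) = shell_weight x * ((- c) * 1)"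
      by (cases "x = 0") (simp_all add: bump_eq_0 shell_weight_def B_trace)
  qed simp
  finally have "c * sphere_int (\<lambda>x::real^3. 1) = 0"
    unfolding sphere_int_cmult by simp
  moreover have "sphere_int (\<lambda>x::real^3. 1) \<noteq> 0"
    using sphere_int_eq_0_imp[of "\<lambda>x::real^3. 1", OF _ _ _ assms(2)] by auto
  ultimately have "c = 0" by simp
  moreover have "x \<noteq> 0" "x /\<^sub>R norm x = x" using assms(2) by auto
  ultimately show ?thesis using c[of x] by simp
qed

end

text \<open>Inverse stereographic projection from the north pole, multiplied by \<open>1 + |z|\<^sup>2\<close>. For \<open>\<alpha> = 1\<close> the
  one-form of \<open>V\<close> is invariant under dilations and annihilates radial vectors, so its pullback does
  not see this factor, and \<open>stereo\<close> is polynomial.\<close>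

definition stereo :: "complex \<Rightarrow> real^3" where
  "stereo z = vector [2 * Re z, 2 * Im z, (Re z)\<^sup>2 + (Im z)\<^sup>2 - 1]"

text \<open>\<open>stereo_u\<close> and \<open>stereo_v\<close> are the partial derivatives of
  \<open>stereo\<close> in the real and imaginary part of \<open>z\<close>.\<close>

definition stereo_u :: "complex \<Rightarrow> real^3" where
  "stereo_u z = vector [2, 0, 2 * Re z]"

definition stereo_v :: "complex \<Rightarrow> real^3" where
  "stereo_v z = vector [0, 2, 2 * Im z]"

lemma stereo_nth [simp]:
  "stereo z $ 1 = 2 * Re z" "stereo z $ 2 = 2 * Im z" "stereo z $ 3 = (Re z)\<^sup>2 + (Im z)\<^sup>2 - 1"
  "stereo_u z $ 1 = 2" "stereo_u z $ 2 = 0" "stereo_u z $ 3 = 2 * Re z"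
  "stereo_v z $ 1 = 0" "stereo_v z $ 2 = 2" "stereo_v z $ 3 = 2 * Im z"
  by (simp_all add: stereo_def stereo_u_def stereo_v_def)

lemma norm_stereo: "norm (stereo z) = 1 + (cmod z)\<^sup>2"
proof -
  have "(norm (stereo z))\<^sup>2 = (1 + (cmod z)\<^sup>2)\<^sup>2"
    unfolding power2_norm_eq_inner[of "stereo z"] inner_vec_def sum_3 cmod_power2
    by (simp add: power2_eq_square algebra_simps)
  then show ?thesis by (rule power2_eq_imp_eq) auto
qed

lemma stereo_nonzero: "stereo z \<noteq> 0"
  using norm_stereo[of z] zero_le_power2[of "cmod z"] by (metis add.commute add_nonneg_pos less_irrefl norm_zero zero_less_one)

lemma has_derivative_stereo:
  "(stereo has_derivative (\<lambda>h. Re h *\<^sub>R stereo_u z + Im h *\<^sub>R stereo_v z)) (at z)"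
proof -
  have eq: "stereo = (\<lambda>z. (2 * Re z) *\<^sub>R axis 1 1 + (2 * Im z) *\<^sub>R axis 2 1 + ((Re z)\<^sup>2 + (Im z)\<^sup>2 - 1) *\<^sub>R axis 3 1)"
    by (simp add: fun_eq_iff vec_eq_iff forall_3 axis_def)
  show ?thesis
    unfolding eq
    by (rule has_derivative_eq_rhs, (rule derivative_intros)+)
       (auto simp: fun_eq_iff vec_eq_iff forall_3 axis_def)
qed

lemma has_derivative_stereo_uv:
  "(stereo_u has_derivative (\<lambda>h. (2 * Re h) *\<^sub>R axis 3 1)) (at z)"
  "(stereo_v has_derivative (\<lambda>h. (2 * Im h) *\<^sub>R axis 3 1)) (at z)"
proof -
  have eq: "stereo_u = (\<lambda>z. (2 *\<^sub>R axis 1 1) + (2 * Re z) *\<^sub>R axis 3 1)"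
    "stereo_v = (\<lambda>z. (2 *\<^sub>R axis 2 1) + (2 * Im z) *\<^sub>R axis 3 1)"
    by (simp_all add: fun_eq_iff vec_eq_iff forall_3 axis_def)
  show "(stereo_u has_derivative (\<lambda>h. (2 * Re h) *\<^sub>R axis 3 1)) (at z)"
    "(stereo_v has_derivative (\<lambda>h. (2 * Im h) *\<^sub>R axis 3 1)) (at z)"
    unfolding eq by (auto intro!: derivative_eq_intros)
qed

lemma norm_stereo_u: "norm (stereo_u z) \<le> 2 * (1 + cmod z)"
proof -
  have "norm (stereo_u z) \<le> (\<Sum>i\<in>UNIV. \<bar>stereo_u z $ i\<bar>)" by (rule norm_le_l1_cart)
  then show ?thesis using abs_Re_le_cmod[of z] by (simp add: sum_3 abs_mult)
qed

lemma norm_stereo_v: "norm (stereo_v z) \<le> 2 * (1 + cmod z)"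
proof -
  have "norm (stereo_v z) \<le> (\<Sum>i\<in>UNIV. \<bar>stereo_v z $ i\<bar>)" by (rule norm_le_l1_cart)
  then show ?thesis using abs_Im_le_cmod[of z] by (simp add: sum_3 abs_mult)
qed

section \<open>The one-form of the flow in the stereographic coordinate\<close>

context irrotational_flow
begin

text \<open>The Cauchy-Riemann equations are the symmetry of \<open>V'\<close> and, with Euler's relation, its vanishing
  trace.\<close>

lemma stereographic_form_holomorphic:
  assumes "\<alpha> = 1"
  shows "(\<lambda>z. Complex (V (stereo z) \<bullet> stereo_u z) (- (V (stereo z) \<bullet> stereo_v z))) holomorphic_on UNIV"
proof (rule holomorphic_onI)
  fix z :: complex
  define T where "T = V' (stereo z)"
  have lin: "linear T" unfolding T_def by (rule deriv_linear[OF stereo_nonzero])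
  have sym: "T a \<bullet> b = a \<bullet> T b" for a b unfolding T_def by (rule deriv_sym[OF stereo_nonzero])
  \<comment> \<open>\<open>a\<close> and \<open>c\<close> are the diagonal partial derivatives of
    the two form components, \<open>b\<close> the common mixed one. The terms
    \<open>2 * V (stereo z) $ 3\<close> come from differentiating \<open>stereo_u\<close> and
    \<open>stereo_v\<close>. With the minus sign on the second component, the Cauchy-Riemann
    equations amount to \<open>a + c = 0\<close> and equality of the mixed derivatives.\<close>
  define a where "a = T (stereo_u z) \<bullet> stereo_u z + 2 * V (stereo z) $ 3"
  define b where "b = T (stereo_u z) \<bullet> stereo_v z"
  define c where "c = T (stereo_v z) \<bullet> stereo_v z + 2 * V (stereo z) $ 3"
  have b': "T (stereo_v z) \<bullet> stereo_u z = b"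
    unfolding b_def sym[of "stereo_v z"] by (simp add: inner_commute)
  have "a + c = 0"
  proof -
    have tr: "T (axis 1 1) $ 1 + T (axis 2 1) $ 2 + T (axis 3 1) $ 3 = 0"
      using deriv_trace[OF stereo_nonzero, of z] unfolding sum_Basis_vec3 T_def by (simp add: inner_axis)
    have s: "T (axis 3 1) $ 1 = T (axis 1 1) $ 3" "T (axis 3 1) $ 2 = T (axis 2 1) $ 3"
      using sym[of "axis 3 1" "axis 1 1"] sym[of "axis 3 1" "axis 2 1"] by (simp_all add: inner_axis inner_axis')
    have "T (stereo z) $ 3 = - V (stereo z) $ 3"
      using deriv_radial[OF stereo_nonzero, of z] assms by (simp add: T_def)
    \<comment> \<open>The third component of Euler's relation, expanded along the axes; with the
      trace condition it makes every term of \<open>a + c\<close> cancel.\<close>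
    then have r: "2 * Re z * T (axis 1 1) $ 3 + 2 * Im z * T (axis 2 1) $ 3
        + ((Re z)\<^sup>2 + (Im z)\<^sup>2 - 1) * T (axis 3 1) $ 3 = - V (stereo z) $ 3"
      by (subst (asm) linear_vec3[OF lin]) simp
    have "a + c = 4 * (T (axis 1 1) $ 1 + T (axis 2 1) $ 2)
      + 8 * (Re z * T (axis 1 1) $ 3 + Im z * T (axis 2 1) $ 3)
      + 4 * ((Re z)\<^sup>2 + (Im z)\<^sup>2) * T (axis 3 1) $ 3 + 4 * V (stereo z) $ 3"
      unfolding a_def c_def linear_vec3[OF lin, of "stereo_u z"] linear_vec3[OF lin, of "stereo_v z"]
      by (simp add: inner_vec_def sum_3 s algebra_simps power2_eq_square)
    also have "\<dots> = 4 * (T (axis 1 1) $ 1 + T (axis 2 1) $ 2 + T (axis 3 1) $ 3)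
      + 4 * (2 * Re z * T (axis 1 1) $ 3 + 2 * Im z * T (axis 2 1) $ 3
        + ((Re z)\<^sup>2 + (Im z)\<^sup>2 - 1) * T (axis 3 1) $ 3 + V (stereo z) $ 3)"
      by (simp add: algebra_simps)
    finally show ?thesis using tr r by simp
  qed
  then have Tvv: "T (stereo_v z) \<bullet> stereo_v z = - a - 2 * V (stereo z) $ 3"
    by (simp add: c_def)
  have dV: "((\<lambda>z. V (stereo z)) has_derivative (\<lambda>h. T (Re h *\<^sub>R stereo_u z + Im h *\<^sub>R stereo_v z))) (at z)"
    unfolding T_def by (rule has_derivative_compose[OF has_derivative_stereo deriv[OF stereo_nonzero]])
  have du: "((\<lambda>z. V (stereo z) \<bullet> stereo_u z) has_derivative (\<lambda>h. a * Re h + b * Im h)) (at z)"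
    by (rule has_derivative_eq_rhs[OF has_derivative_inner[OF dV has_derivative_stereo_uv(1)]])
       (simp add: fun_eq_iff linear_add[OF lin] linear_scale[OF lin] inner_add_left b' a_def inner_axis algebra_simps)
  have dv: "((\<lambda>z. V (stereo z) \<bullet> stereo_v z) has_derivative (\<lambda>h. b * Re h - a * Im h)) (at z)"
    by (rule has_derivative_eq_rhs[OF has_derivative_inner[OF dV has_derivative_stereo_uv(2)]])
       (simp add: fun_eq_iff linear_add[OF lin] linear_scale[OF lin] inner_add_left b_def Tvv inner_axis algebra_simps)
  have "((\<lambda>z. of_real (V (stereo z) \<bullet> stereo_u z) - \<i> * of_real (V (stereo z) \<bullet> stereo_v z))
      has_derivative (\<lambda>h. of_real (a * Re h + b * Im h) - \<i> * of_real (b * Re h - a * Im h))) (at z)"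
    by (intro has_derivative_diff has_derivative_mult_right has_derivative_of_real du dv)
  then have "((\<lambda>z. Complex (V (stereo z) \<bullet> stereo_u z) (- (V (stereo z) \<bullet> stereo_v z)))
      has_derivative (\<lambda>h. Complex a (- b) * h)) (at z)"
    by (rule has_derivative_transform_within_open[where s = UNIV, THEN has_derivative_eq_rhs])
       (auto simp: complex_eq_iff fun_eq_iff algebra_simps)
  then show "(\<lambda>z. Complex (V (stereo z) \<bullet> stereo_u z) (- (V (stereo z) \<bullet> stereo_v z)))
      field_differentiable at z within UNIV"
    unfolding field_differentiable_def has_field_derivative_def by blast
qed

text \<open>For degree -1 the velocity at \<open>stereo z\<close> is of order 1/(1 + |z|^2), since
  \<open>v\<close> is bounded and \<open>f\<close> vanishes, while \<open>stereo_u\<close> and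
  \<open>stereo_v\<close> grow linearly; so the form decays like 1/|z|.\<close>

lemma stereographic_form_eq_0:
  assumes "\<alpha> = 1" "continuous_on S2 v"
  shows "V (stereo z) \<bullet> stereo_u z = 0 \<and> V (stereo z) \<bullet> stereo_v z = 0"
proof -
  let ?w = "\<lambda>z. Complex (V (stereo z) \<bullet> stereo_u z) (- (V (stereo z) \<bullet> stereo_v z))"
  have "bounded (v ` S2)"
    by (intro compact_imp_bounded compact_continuous_image assms) auto
  then obtain M where M: "M > 0" "\<And>x. x \<in> S2 \<Longrightarrow> norm (v x) \<le> M"
    unfolding bounded_pos by auto
  have bound: "norm (?w z) \<le> 8 * M * norm (inverse z)" if "cmod z \<ge> 1" for z
  proof -
    let ?n = "stereo z /\<^sub>R norm (stereo z)"
    have n: "?n \<in> S2" by (rule normalize_in_sphere[OF stereo_nonzero])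
    have "V (stereo z) = inverse (norm (stereo z)) *\<^sub>R v ?n"
      using stereo_nonzero[of z] assms(1) radial_part_eq_0[OF assms(1) n] by (simp add: velocity_alt powr_minus)
    then have "norm (V (stereo z)) = inverse (norm (stereo z)) * norm (v ?n)"
      by simp
    also have "\<dots> \<le> inverse (norm (stereo z)) * M"
      by (intro mult_left_mono M(2) n) auto
    finally have Vb: "norm (V (stereo z)) \<le> M / (1 + (cmod z)\<^sup>2)"
      by (simp add: norm_stereo divide_inverse mult.commute)
    have "norm (?w z) \<le> \<bar>V (stereo z) \<bullet> stereo_u z\<bar> + \<bar>V (stereo z) \<bullet> stereo_v z\<bar>"
      using cmod_le[of "?w z"] by simp
    also have "\<dots> \<le> norm (V (stereo z)) * norm (stereo_u z) + norm (V (stereo z)) * norm (stereo_v z)"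
      by (intro add_mono Cauchy_Schwarz_ineq2)
    also have "\<dots> \<le> norm (V (stereo z)) * (2 * (1 + cmod z)) + norm (V (stereo z)) * (2 * (1 + cmod z))"
      by (intro add_mono mult_left_mono norm_stereo_u norm_stereo_v) auto
    also have "\<dots> = norm (V (stereo z)) * (4 * (1 + cmod z))" by simp
    also have "\<dots> \<le> M / (1 + (cmod z)\<^sup>2) * (4 * (1 + cmod z))"
      by (intro mult_right_mono Vb) auto
    \<comment> \<open>For |z| at least 1 the factor 1 + |z| is at most 2|z|; this produces the
      constant 8.\<close>
    also have "\<dots> \<le> M / (cmod z)\<^sup>2 * (4 * (2 * cmod z))"
    proof (intro mult_mono)
      show "M / (1 + (cmod z)\<^sup>2) \<le> M / (cmod z)\<^sup>2"
        using M(1) that by (intro divide_left_mono) (auto intro!: mult_pos_pos add_pos_nonneg)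
    qed (use that M(1) in auto)
    also have "\<dots> = 8 * M * norm (inverse z)"
    proof -
      have "cmod z \<noteq> 0" using that by auto
      then show ?thesis unfolding norm_inverse by (simp add: power2_eq_square field_simps)
    qed
    finally show ?thesis .
  qed
  have "(?w \<longlongrightarrow> 0) at_infinity"
  proof (rule Lim_null_comparison)
    show "\<forall>\<^sub>F z in at_infinity. norm (?w z) \<le> 8 * M * norm (inverse z)"
      unfolding eventually_at_infinity using bound by blast
    show "((\<lambda>z::complex. 8 * M * norm (inverse z)) \<longlongrightarrow> 0) at_infinity"
      by (intro tendsto_mult_right_zero tendsto_norm_zero tendsto_inverse_0)
  qed
  then have "?w z = 0"
    by (rule Liouville_weak_0[OF stereographic_form_holomorphic[OF assms(1)]])
  then show ?thesis by (simp add: complex_eq_iff)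
qed

text \<open>\<open>V\<close> is orthogonal to \<open>stereo_u\<close>, \<open>stereo_v\<close> and,
  as \<open>f = 0\<close>, to the position vector. These span three-space: eliminating the first two
  components leaves 1 + |z|^2 times the third.\<close>

lemma velocity_stereo_eq_0:
  assumes "\<alpha> = 1" "continuous_on S2 v"
  shows "V (stereo z) = 0"
proof -
  let ?W = "V (stereo z)"
  note uv = stereographic_form_eq_0[OF assms, of z]
  have "?W \<bullet> stereo z = 0"
    using velocity_radial[OF stereo_nonzero] radial_part_eq_0[OF assms(1) normalize_in_sphere[OF stereo_nonzero]]
    by simp
  with uv have e': "?W $ 1 * 2 + ?W $ 3 * (2 * Re z) = 0" "?W $ 2 * 2 + ?W $ 3 * (2 * Im z) = 0"
    and e3: "?W $ 1 * (2 * Re z) + ?W $ 2 * (2 * Im z) + ?W $ 3 * ((Re z)\<^sup>2 + (Im z)\<^sup>2 - 1) = 0"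
    by (simp_all add: inner_vec_def sum_3)
  from e' have e: "?W $ 1 = - (Re z * ?W $ 3)" "?W $ 2 = - (Im z * ?W $ 3)"
    by (simp_all add: algebra_simps)
  have "?W $ 3 * (1 + (Re z)\<^sup>2 + (Im z)\<^sup>2) = 0"
    using e3 unfolding e by (simp add: algebra_simps power2_eq_square)
  moreover have "1 + (Re z)\<^sup>2 + (Im z)\<^sup>2 \<noteq> 0"
    using add_pos_nonneg[of 1 "(Re z)\<^sup>2 + (Im z)\<^sup>2"] by (simp add: add.assoc)
  ultimately have "?W $ 3 = 0" by simp
  then show ?thesis using e by (simp add: vec_eq_iff forall_3)
qed

text \<open>The stereographic coordinate reaches every point but the north pole, where continuity of
  \<open>V\<close> finishes the argument.\<close>

lemma tangential_part_eq_0: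
  assumes "\<alpha> = 1" "continuous_on S2 v" "y \<in> S2"
  shows "v y = 0"
proof -
  have V_v: "V x = inverse (norm x) *\<^sub>R v (x /\<^sub>R norm x)" if "x \<noteq> 0" for x
    using that assms(1) radial_part_eq_0[OF assms(1) normalize_in_sphere[OF that]]
    by (simp add: velocity_alt powr_minus)
  have off_pole: "v y = 0" if y: "y \<in> S2" "y $ 3 \<noteq> 1" for y :: "real^3"
  proof -
    have n: "(y $ 1)\<^sup>2 + (y $ 2)\<^sup>2 + (y $ 3)\<^sup>2 = 1"
      using y by (simp add: norm_vec_def L2_set_def sum_3)
    then have "(y $ 3)\<^sup>2 \<le> 1" using sum_power2_ge_zero[of "y $ 1" "y $ 2"] by linarith
    then have lt: "y $ 3 < 1" using y(2) abs_square_le_1[of "y $ 3"] by simp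
    \<comment> \<open>The stereographic projection of \<open>y\<close> from the north pole.\<close>
    define z where "z = Complex (y $ 1 / (1 - y $ 3)) (y $ 2 / (1 - y $ 3))"
    have eq: "stereo z = (2 / (1 - y $ 3)) *\<^sub>R y"
    proof -
      have "(y $ 1)\<^sup>2 + (y $ 2)\<^sup>2 = (1 - y $ 3) * (1 + y $ 3)"
        using n by (simp add: algebra_simps power2_eq_square)
      then have s: "(Re z)\<^sup>2 + (Im z)\<^sup>2 = (1 + y $ 3) / (1 - y $ 3)"
        using lt by (simp add: z_def power_divide add_divide_distrib[symmetric] power2_eq_square)
      have "(Re z)\<^sup>2 + (Im z)\<^sup>2 - 1 = 2 / (1 - y $ 3) * y $ 3"
        unfolding s using lt by (simp add: field_simps)
      then show ?thesis
        by (simp add: vec_eq_iff forall_3 z_def)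
    qed
    have "stereo z /\<^sub>R norm (stereo z) = y"
    proof -
      define k where "k = 2 / (1 - y $ 3)"
      have "k > 0" using lt by (simp add: k_def)
      then show ?thesis using y unfolding eq k_def[symmetric] by simp
    qed
    then show ?thesis
      using velocity_stereo_eq_0[OF assms(1,2), of z] V_v[OF stereo_nonzero, of z] stereo_nonzero[of z] by simp
  qed
  show ?thesis
  proof (cases "y $ 3 = 1")
    case False
    then show ?thesis using off_pole assms(3) by blast
  next
    case True
    \<comment> \<open>Points tending to the pole with nonzero first coordinate; their normalisations
      are therefore different from the pole. They need not lie on the sphere, because
      \<open>V\<close> is defined off it.\<close>
    define q where "q n = y + inverse (real (Suc n)) *\<^sub>R axis 1 1" for n
    have n: "(y $ 1)\<^sup>2 + (y $ 2)\<^sup>2 + (y $ 3)\<^sup>2 = 1"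
      using assms(3) by (simp add: norm_vec_def L2_set_def sum_3)
    then have y12: "y $ 1 = 0" using True by (simp add: sum_power2_eq_zero_iff)
    have "V (q n) = 0" for n
    proof -
      have q: "q n $ 1 \<noteq> 0" by (simp add: q_def y12 axis_def)
      then have q0: "q n \<noteq> 0" by auto
      have "(q n /\<^sub>R norm (q n)) $ 3 \<noteq> 1"
      proof
        assume 1: "(q n /\<^sub>R norm (q n)) $ 3 = 1"
        have "((q n /\<^sub>R norm (q n)) $ 1)\<^sup>2 + ((q n /\<^sub>R norm (q n)) $ 2)\<^sup>2 + ((q n /\<^sub>R norm (q n)) $ 3)\<^sup>2 = 1"
          using normalize_in_sphere[OF q0] by (simp only: norm_vec_def L2_set_def sum_3 mem_sphere dist_0_norm) simp
        then have "((q n /\<^sub>R norm (q n)) $ 1) = 0"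
          unfolding 1 by (simp add: sum_power2_eq_zero_iff)
        then show False using q q0 by simp
      qed
      then show ?thesis
        using off_pole[OF normalize_in_sphere[OF q0]] V_v[OF q0] by simp
    qed
    moreover have "(\<lambda>n. V (q n)) \<longlonglongrightarrow> V y"
    proof -
      have "isCont V y"
        by (rule has_derivative_continuous[OF deriv]) (use assms(3) in auto)
      moreover have "q \<longlonglongrightarrow> y + 0 *\<^sub>R axis 1 1"
        unfolding q_def[abs_def] by (intro tendsto_intros LIMSEQ_inverse_real_of_nat)
      ultimately show ?thesis
        using isCont_tendsto_compose[of y V q sequentially] by simp
    qed
    ultimately have "V y = 0" by (simp add: LIMSEQ_const_iff)
    moreover have "y \<noteq> 0" using assms(3) by auto
    ultimately show ?thesis using V_v[of y] assms(3) by simp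
  qed
qed

section \<open>The Bernoulli function\<close>

text \<open>By the symmetry of \<open>V'\<close>, the advection term is half the gradient of \<open>V \<bullet> V\<close>.\<close>

lemma bernoulli_const:
  assumes p: "C1_on_S2 p"
    and euler: "\<And>x. x \<noteq> 0 \<Longrightarrow> advection V V x + grad (pressure \<alpha> p) x = 0"
  shows "\<exists>b. (\<alpha> \<noteq> 0 \<longrightarrow> b = 0) \<and> (\<forall>x\<in>S2. bernoulli v f p x = 2 * b)"
proof -
  obtain P' where P': "\<And>x. x \<noteq> 0 \<Longrightarrow> (pressure \<alpha> p has_derivative P' x) (at x)"
    using C1_off_0_pressure[OF p, of \<alpha>] by (rule C1_off_0E) (rule that; assumption)
  define E where "E x = V x \<bullet> V x + 2 * pressure \<alpha> p x" for x
  have "(E has_derivative (\<lambda>h. 0)) (at x)" if x: "x \<noteq> 0" for x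
  proof -
    have lP: "linear (P' x)" using has_derivative_linear[OF P'[OF x]] .
    have adv: "advection V V x = V' x (V x)"
      unfolding advection_def partial_eq[OF deriv[OF x]] sum_3 by (rule linear_vec3[OF deriv_linear[OF x], symmetric])
    have gr: "P' x h = grad (pressure \<alpha> p) x \<bullet> h" for h
      unfolding grad_def partial_eq[OF P'[OF x]] linear_vec3[OF lP, of h] inner_vec_def sum_3
      by (simp add: mult.commute)
    have "V x \<bullet> V' x h + V' x h \<bullet> V x + 2 * P' x h = 0" for h
    proof -
      have "V x \<bullet> V' x h + V' x h \<bullet> V x + 2 * P' x h
          = 2 * ((advection V V x + grad (pressure \<alpha> p) x) \<bullet> h)"
        using deriv_sym[OF x, of h "V x"]
        by (simp add: adv gr inner_add_left inner_commute[of "V x"] inner_commute[of h])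
      then show ?thesis using euler[OF x] by simp
    qed
    moreover have "(E has_derivative (\<lambda>h. V x \<bullet> V' x h + V' x h \<bullet> V x + 2 * P' x h)) (at x)"
      unfolding E_def[abs_def]
      by (intro has_derivative_add has_derivative_mult_right has_derivative_inner deriv P' x)
    ultimately show ?thesis by simp
  qed
  then obtain c where c: "\<And>x. x \<noteq> 0 \<Longrightarrow> E x = c"
    using constant_of_zero_derivative_off_0[of E] by auto
  have E_S2: "E x = bernoulli v f p x" if "x \<in> S2" for x
  proof -
    have "E x = (v x + f x *\<^sub>R x) \<bullet> (v x + f x *\<^sub>R x) + 2 * p x"
      using that by (simp add: E_def velocity_alt pressure_alt)
    also have "\<dots> = bernoulli v f p x"
    proof -
      have "x \<bullet> x = 1" using that by (simp add: dot_square_norm)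
      then have "(v x + f x *\<^sub>R x) \<bullet> (v x + f x *\<^sub>R x) = v x \<bullet> v x + (f x)\<^sup>2"
        using tangent[OF that] inner_commute[of x "v x"]
        by (simp add: inner_add_left inner_add_right power2_eq_square)
      then show ?thesis unfolding bernoulli_def power2_norm_eq_inner by simp
    qed
    finally show ?thesis .
  qed
  have "c = 0" if "\<alpha> \<noteq> 0"
  proof -
    \<comment> \<open>\<open>E\<close> has the same value at \<open>e\<close> and at its double,
      while homogeneity multiplies it by 2^(-2 \<alpha>), which differs from 1.\<close>
    define e where "e = axis (1::3) (1::real)"
    have e: "e \<noteq> 0" by (simp add: e_def axis_eq_0_iff)
    have "norm e = 1" by (simp add: e_def norm_eq_1 inner_axis_axis)
    then have "pressure \<alpha> p (2 *\<^sub>R e) = 2 powr - (2 * \<alpha>) * pressure \<alpha> p e"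
      by (simp add: pressure_alt)
    moreover have "2 powr - (2 * \<alpha>) = 2 powr - \<alpha> * 2 powr - \<alpha>"
      by (simp add: powr_add[symmetric])
    ultimately have "E (2 *\<^sub>R e) = 2 powr - (2 * \<alpha>) * E e"
      by (simp add: E_def velocity_homogeneous distrib_left)
    then have "c = 2 powr - (2 * \<alpha>) * c"
      using c[of e] c[of "2 *\<^sub>R e"] e by simp
    moreover have "2 powr - (2 * \<alpha>) \<noteq> 1"
      using that by (simp add: powr_eq_one_iff_gen)
    ultimately show ?thesis by simp
  qed
  moreover have "bernoulli v f p x = 2 * (c / 2)" if "x \<in> S2" for x
  proof -
    have "x \<noteq> 0" using that by auto
    then show ?thesis using E_S2[OF that] c by simp
  qed
  ultimately show ?thesis by (intro exI[of _ "c / 2"]) auto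
qed

end

text \<open>The constant \<open>b\<close> is the freedom to shift the pressure when
  \<open>\<alpha> = 0\<close>; otherwise it is 0 and so is the Bernoulli function. The sum over
  \<open>m\<close> is a general element of the eigenspace, which is rotation invariant and so
  singles out no particular order.\<close>

theorem proposition3p1:
  fixes \<alpha> :: real
    and v :: "real^3 \<Rightarrow> real^3"
    and f p :: "real^3 \<Rightarrow> real"
  assumes "C1_solution \<alpha> v f p"
    and "\<not> trivial_solution v f p"
    and "\<forall>x. x \<noteq> 0 \<longrightarrow> vorticity \<alpha> v f x = 0"
  shows "\<alpha> \<in> \<int> - {1}
    \<and> (\<forall>x\<in>S2. (1 - \<alpha>) *\<^sub>R v x = surface_grad f x)
    \<and> (\<exists>l::int. 1 - \<alpha> = of_int l \<and>
         (\<exists>c :: int \<Rightarrow> real. \<forall>x\<in>S2.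
            f x = (\<Sum>m = - int (harm_degree l)..int (harm_degree l).
                     c m * sph_harm (harm_degree l) m x)))
    \<and> (\<exists>b::real. (\<alpha> \<noteq> 0 \<longrightarrow> b = 0) \<and>
         (\<forall>x\<in>S2. p x = - (1/2) * (f x)\<^sup>2
                      - 1 / (2 * (1 - \<alpha>)\<^sup>2) * (norm (surface_grad f x))\<^sup>2 + b) \<and>
         (\<forall>x\<in>S2. bernoulli v f p x = 2 * b))"
proof -
  have C1: "C1_on_S2 v" "C1_on_S2 f" "C1_on_S2 p" and tangent: "tangent_field v"
    and euler: "\<And>x. x \<noteq> 0 \<Longrightarrow>
        advection (velocity \<alpha> v f) (velocity \<alpha> v f) x + grad (pressure \<alpha> p) x = 0"
    and div: "\<And>x. x \<noteq> 0 \<Longrightarrow> divergence (velocity \<alpha> v f) x = 0"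
    using assms(1) unfolding C1_solution_def by auto
  obtain V' where V': "\<And>x. x \<noteq> 0 \<Longrightarrow> (velocity \<alpha> v f has_derivative V' x) (at x)"
    "\<And>e. continuous_on (- {0}) (\<lambda>x. V' x e)"
    using C1_off_0_velocity[OF C1(1,2)] by (rule C1_off_0E) (rule that; assumption)
  have partial: "partial i (velocity \<alpha> v f) x = V' x (axis i 1)" if "x \<noteq> 0" for i x
    by (rule partial_eq[OF V'(1)[OF that]])
  interpret irrotational_flow \<alpha> v f V'
  proof
    show "v x \<bullet> x = 0" if "x \<in> S2" for x
      using tangent that by (auto simp: tangent_field_def)
    fix x :: "real^3" assume x: "x \<noteq> 0"
    show "(velocity \<alpha> v f has_derivative V' x) (at x)" by (rule V'(1)[OF x])
    have "curl (velocity \<alpha> v f) x = 0" using assms(3) x by (simp add: vorticity_def)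
    then have "V' x (axis 2 1) $ 3 = V' x (axis 3 1) $ 2" "V' x (axis 3 1) $ 1 = V' x (axis 1 1) $ 3"
      "V' x (axis 1 1) $ 2 = V' x (axis 2 1) $ 1"
      by (auto simp: curl_def partial[OF x] vec_eq_iff forall_3)
    then show "V' x a \<bullet> b = a \<bullet> V' x b" for a b
      by (intro linear_symmetric_of_curl has_derivative_linear[OF V'(1)[OF x]])
    show "(\<Sum>i\<in>Basis. V' x i \<bullet> i) = 0"
      using div[OF x] unfolding sum_Basis_vec3 divergence_def partial[OF x] sum_3 by (simp add: inner_axis)
  qed (rule V'(2))
  obtain b where b': "(\<alpha> \<noteq> 0 \<longrightarrow> b = 0) \<and> (\<forall>x\<in>S2. bernoulli v f p x = 2 * b)"
    using bernoulli_const[OF C1(3) euler] by blast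
  then have b: "\<alpha> \<noteq> 0 \<Longrightarrow> b = 0" "\<And>x. x \<in> S2 \<Longrightarrow> bernoulli v f p x = 2 * b"
    by blast+
  have v_cont: "continuous_on S2 v"
  proof -
    have "continuous_on S2 (\<lambda>x. v (x /\<^sub>R norm x))"
      using C1_off_0_normalize[OF C1(1)]
      by (rule C1_off_0E) (erule continuous_on_subset, auto)
    then show ?thesis by (rule continuous_on_eq) simp
  qed
  \<comment> \<open>When \<open>v\<close> and \<open>f\<close> vanish, the Bernoulli function
    reduces to \<open>2 * p\<close>, so for nonzero \<alpha> the pressure vanishes as well.\<close>
  have trivial: "False" if "\<And>x. x \<in> S2 \<Longrightarrow> v x = 0" "\<And>x. x \<in> S2 \<Longrightarrow> f x = 0" "\<alpha> \<noteq> 0"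
    using assms(2) b that by (auto simp: trivial_solution_def bernoulli_def)
  have ne1: "\<alpha> \<noteq> 1"
    using trivial tangential_part_eq_0[OF _ v_cont] radial_part_eq_0 by auto
  have grad: "(1 - \<alpha>) *\<^sub>R v x = surface_grad f x" if "x \<in> S2" for x
    by (rule surface_grad_eq[OF that, symmetric])
  have "\<exists>L::nat. (1 - \<alpha>) * (2 - \<alpha>) = real L * (real L + 1)"
  proof (rule ccontr)
    assume no: "\<nexists>L::nat. (1 - \<alpha>) * (2 - \<alpha>) = real L * (real L + 1)"
    then have f0: "f x = 0" if "x \<in> S2" for x
      using eigenfunction_eq_0[OF eigenfunction_f _ that] by blast
    have "v x = 0" if "x \<in> S2" for x
    proof -
      have x: "x \<noteq> 0" using that by auto
      \<comment> \<open>\<open>f\<close> vanishes on the sphere, so its extension vanishes off the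
        origin and has gradient 0; as \<alpha> differs from 1, \<open>v\<close> is 0 too.\<close>
      have "((\<lambda>y. f (y /\<^sub>R norm y)) has_derivative (\<lambda>h. 0)) (at x)"
        by (rule has_derivative_transform_within_open[where f = "\<lambda>_. 0" and s = "- {0}"])
           (use x f0[OF normalize_in_sphere] in \<open>auto simp: open_Compl\<close>)
      from has_derivative_unique[OF f_deriv[OF x] this] have "grad_f x \<bullet> grad_f x = 0"
        by (rule fun_cong)
      then show ?thesis using grad_f_eq[OF x] ne1 that x by simp
    qed
    \<comment> \<open>For \<open>\<alpha> = 0\<close> the eigenvalue is 2, the one of degree 1,
      which the assumption \<open>no\<close> excludes.\<close>
    moreover have "\<alpha> \<noteq> 0"
    proof
      assume "\<alpha> = 0"
      then have "(1 - \<alpha>) * (2 - \<alpha>) = real 1 * (real 1 + 1)" by simp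
      then show False using no by blast
    qed
    ultimately show False using trivial f0 by blast
  qed
  then obtain L :: nat where L: "(1 - \<alpha>) * (2 - \<alpha>) = real L * (real L + 1)" by blast
  \<comment> \<open>The eigenvalue determines 1 - \<alpha> only up to the reflection of l to - l -
    1; \<open>harm_degree\<close> sends both roots to the same \<open>L\<close>.\<close>
  then have "(1 - \<alpha> - real L) * (1 - \<alpha> + real L + 1) = 0" by (simp add: algebra_simps)
  then have "1 - \<alpha> = real L \<or> 1 - \<alpha> = - real L - 1" by auto
  then obtain l :: int where l: "1 - \<alpha> = of_int l" "harm_degree l = L"
  proof
    assume "1 - \<alpha> = real L"
    then show thesis by (intro that[of "int L"]) (auto simp: harm_degree_def)
  next
    assume "1 - \<alpha> = - real L - 1"
    then show thesis by (intro that[of "- int L - 1"]) (auto simp: harm_degree_def)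
  qed
  have "\<alpha> = of_int (1 - l)" using l(1) by simp
  then have "\<alpha> \<in> \<int> - {1}" using ne1 by (metis Diff_iff Ints_of_int singletonD)
  moreover obtain c where "\<forall>x\<in>S2. f x = (\<Sum>m = - int L..int L. c m * sph_harm L m x)"
    using eigenfunction_eq_sph_harm_sum[OF eigenfunction_f[unfolded L]] by blast
  moreover have "p x = - (1/2) * (f x)\<^sup>2 - 1 / (2 * (1 - \<alpha>)\<^sup>2) * (norm (surface_grad f x))\<^sup>2 + b"
    if "x \<in> S2" for x
  proof -
    have "(norm (surface_grad f x))\<^sup>2 = (1 - \<alpha>)\<^sup>2 * (norm (v x))\<^sup>2"
      unfolding grad[OF that, symmetric] by (simp add: power_mult_distrib)
    then have "1 / (2 * (1 - \<alpha>)\<^sup>2) * (norm (surface_grad f x))\<^sup>2 = (norm (v x))\<^sup>2 / 2"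
      using ne1 by simp
    moreover have "(norm (v x))\<^sup>2 + (f x)\<^sup>2 + 2 * p x = 2 * b"
      using b(2)[OF that] by (simp add: bernoulli_def)
    ultimately show ?thesis by linarith
  qed
  ultimately show ?thesis
    using l grad b by blast
qed

end
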